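(* Let $G$ and $G'$ each be both a groupoid and a topological space (no compatibility assumed) with Hausdorff unit space and gradings $\mathsf{c}:G\to\Gamma$, $\mathsf{c}':G'\to\Gamma$ into the same groupoid $\Gamma$, and let $Y$ and $Y'$ be unital $1$-cancellative semigroups. If $S\subseteq{}_Y\mathcal{B}^\circ_\mathsf{h}(G)$ and $S'\subseteq{}_{Y'}\mathcal{B}^\circ_\mathsf{h}(G')$ are bumpy semigroups and there is a diagonal-preserving graded semigroup isomorphism $S\to S'$, then $G$ and $G'$ are isomorphic graded étale groupoids, i.e. $G$ and $G'$ are étale and there is a groupoid isomorphism $\psi:G\to G'$ that is a homeomorphism with $\mathsf{c}'\circ\psi=\mathsf{c}$.
   Context: For a groupoid $G$: $\mathsf{s}(g)=g^{-1}g$, $\mathsf{r}(g)=gg^{-1}$; $G^0$ is the set of units; $gh$ is defined iff $\mathsf{s}(g)=\mathsf{r}(h)$; for $X,X'\subseteq G$, $XX'=\{xx':x\in X,x'\in X',\mathsf{s}(x)=\mathsf{r}(x')\}$ and $X^{-1}=\{x^{-1}:x\in X\}$. A bisection is $B\subseteq G$ with $BB^{-1}\cup B^{-1}B\subseteq G^0$. $\mathcal{O}(G)$ is the topology of $G$; $\mathrm{int}$ denotes interior in $G$. $G$ is étale if inversion and multiplication are continuous and $\mathsf{s}$ is a local homeomorphism onto an open subset of $G$. A grading $\mathsf{c}:G\to\Gamma$ is a map with $\mathsf{c}(xy)=\mathsf{c}(x)\mathsf{c}(y)$ (the right side being defined) whenever $xy$ is defined. $H\subseteq G$ is homogeneous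 if $\mathsf{c}$ is constant on $H$; $\mathcal{B}^\circ_\mathsf{h}(G)$ is the set of homogeneous open bisections. A unital semigroup $Y$ is $1$-cancellative if for all $x,y\in Y$: $xy=x\Leftrightarrow y=1\Leftrightarrow yx=x$. $Y^\times$ denotes its invertible elements. For a family $\mathcal{X}$ of subsets of $G$, ${}_Y\mathcal{X}$ is the set of partial functions $a$ from $G$ to $Y$ with domain $\mathrm{dom}(a)\in\mathcal{X}$. For $W\subseteq Y$, $[W]a=\{g\in\mathrm{dom}(a):a(g)\in W\}$, and $[1]a=[\{1\}]a$. If $\mathrm{dom}(a)$ or $\mathrm{dom}(b)$ is a bisection, $ab$ is the function with domain $\mathrm{dom}(a)\mathrm{dom}(b)$ given by $ab(gh)=a(g)b(h)$ for $g\in\mathrm{dom}(a)$, $h\in\mathrm{dom}(b)$, $\mathsf{s}(g)=\mathsf{r}(h)$; semigroups of functions carry this product. $S\subseteq{}_Y\mathcal{B}^\circ_\mathsf{h}(G)$ is bumpy if: (1-Proper) $[1]a$ is compact for all $a\in S$; (Urysohn) the empty function $\emptyset$ is in $S$, and whenever $g\in O\in\mathcal{O}(G)$ there is $a\in S$ with $\mathrm{dom}(a)\subseteq O$ and $g\in\mathrm{int}([Y^\times]a)$; (Involutive) whenever $a\in S$ and $g\in\mathrm{int}([Y^\times]a)$, there is $b\in S$ with $g^{-1}\in\mathrm{int}(\{h\in G:a(h^{-1})=b(h)^{-1}\})$. For $a\in S\setminus\{\emptyset\}$, $\mathsf{c}(a)\in\Gamma$ is the element with $\mathsf{c}[\mathrm{dom}(a)]=\{\mathsf{c}(a)\}$,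 and similarly for $\mathsf{c}'$ on $S'\setminus\{\emptyset\}$. An isomorphism $\phi:S\to S'$ is graded if $\mathsf{c}(a)=\mathsf{c}'(\phi(a))$ for all $a\in S\setminus\{\emptyset\}$. With $\mathsf{D}(S)=\{d\in S:\mathrm{dom}(d)\subseteq G^0\}$, $\phi$ is diagonal-preserving if $\phi[\mathsf{D}(S)]=\mathsf{D}(S')$. *)

theory Defs
  imports "HOL-Analysis.Analysis" "HOL-Algebra.Group"
begin

section \<open>Groupoids\<close>

text \<open>The partial product is a total operation whose values are only meaningful on composable
  pairs, i.e. pairs with \<open>src g = rng h\<close>.  The carrier may be empty.\<close>

record 'a groupoid = "'a partial_object" +
  gmult :: "'a \<Rightarrow> 'a \<Rightarrow> 'a" (infixl \<open>\<cdot>\<index>\<close> 70)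
  ginv :: "'a \<Rightarrow> 'a"

definition src :: "('a, 'm) groupoid_scheme \<Rightarrow> 'a \<Rightarrow> 'a" where
  "src G g = ginv G g \<cdot>\<^bsub>G\<^esub> g"

definition rng :: "('a, 'm) groupoid_scheme \<Rightarrow> 'a \<Rightarrow> 'a" where
  "rng G g = g \<cdot>\<^bsub>G\<^esub> ginv G g"

definition units :: "('a, 'm) groupoid_scheme \<Rightarrow> 'a set" where
  "units G = src G ` carrier G"

definition composable :: "('a, 'm) groupoid_scheme \<Rightarrow> ('a \<times> 'a) set" where
  "composable G = {(g, h). g \<in> carrier G \<and> h \<in> carrier G \<and> src G g = rng G h}"

locale groupoid =
  fixes G :: "('a, 'm) groupoid_scheme" (structure)
  assumes ginv_closed: "g \<in> carrier G \<Longrightarrow> ginv G g \<in> carrier G"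
    and ginv_ginv: "g \<in> carrier G \<Longrightarrow> ginv G (ginv G g) = g"
    and gmult_closed: "(g, h) \<in> composable G \<Longrightarrow> g \<cdot> h \<in> carrier G"
    and src_gmult: "(g, h) \<in> composable G \<Longrightarrow> src G (g \<cdot> h) = src G h"
    and rng_gmult: "(g, h) \<in> composable G \<Longrightarrow> rng G (g \<cdot> h) = rng G g"
    and gmult_assoc: "\<lbrakk>(g, h) \<in> composable G; (h, k) \<in> composable G\<rbrakk>
      \<Longrightarrow> (g \<cdot> h) \<cdot> k = g \<cdot> (h \<cdot> k)"
    and rng_left_unit: "g \<in> carrier G \<Longrightarrow> rng G g \<cdot> g = g"
    and src_right_unit: "g \<in> carrier G \<Longrightarrow> g \<cdot> src G g = g"

definition groupoid_hom ::
    "('a, 'm) groupoid_scheme \<Rightarrow> ('b, 'n) groupoid_scheme \<Rightarrow> ('a \<Rightarrow> 'b) \<Rightarrow> bool" where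
  "groupoid_hom G H f \<longleftrightarrow> f ` carrier G \<subseteq> carrier H \<and>
     (\<forall>(g, h) \<in> composable G.
        (f g, f h) \<in> composable H \<and> f (g \<cdot>\<^bsub>G\<^esub> h) = f g \<cdot>\<^bsub>H\<^esub> f h)"

definition groupoid_iso ::
    "('a, 'm) groupoid_scheme \<Rightarrow> ('b, 'n) groupoid_scheme \<Rightarrow> ('a \<Rightarrow> 'b) \<Rightarrow> bool" where
  "groupoid_iso G H f \<longleftrightarrow> bij_betw f (carrier G) (carrier H) \<and>
     groupoid_hom G H f \<and> groupoid_hom H G (inv_into (carrier G) f)"

abbreviation grading ::
    "('a, 'm) groupoid_scheme \<Rightarrow> ('b, 'n) groupoid_scheme \<Rightarrow> ('a \<Rightarrow> 'b) \<Rightarrow> bool" where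
  "grading G \<Gamma> c \<equiv> groupoid_hom G \<Gamma> c"

definition setprod :: "('a, 'm) groupoid_scheme \<Rightarrow> 'a set \<Rightarrow> 'a set \<Rightarrow> 'a set" where
  "setprod G A B = {a \<cdot>\<^bsub>G\<^esub> b | a b. a \<in> A \<and> b \<in> B \<and> src G a = rng G b}"

definition bisection :: "('a, 'm) groupoid_scheme \<Rightarrow> 'a set \<Rightarrow> bool" where
  "bisection G B \<longleftrightarrow> B \<subseteq> carrier G \<and>
     setprod G B (ginv G ` B) \<union> setprod G (ginv G ` B) B \<subseteq> units G"


section \<open>Topology\<close>

definition local_homeomorphism :: "'a topology \<Rightarrow> 'b topology \<Rightarrow> ('a \<Rightarrow> 'b) \<Rightarrow> bool" where
  "local_homeomorphism X Z f \<longleftrightarrow> (\<forall>x \<in> topspace X. \<exists>U. openin X U \<and> x \<in> U \<and> openin Z (f ` U) \<and>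
     homeomorphic_map (subtopology X U) (subtopology Z (f ` U)) f)"

definition etale :: "('a, 'm) groupoid_scheme \<Rightarrow> 'a topology \<Rightarrow> bool" where
  "etale G T \<longleftrightarrow>
     continuous_map T T (ginv G) \<and>
     continuous_map (subtopology (prod_topology T T) (composable G)) T (\<lambda>(g, h). g \<cdot>\<^bsub>G\<^esub> h) \<and>
     openin T (src G ` carrier G) \<and>
     local_homeomorphism T (subtopology T (src G ` carrier G)) (src G)"

definition homog_open_bisections ::
    "('a, 'm) groupoid_scheme \<Rightarrow> 'a topology \<Rightarrow> ('a \<Rightarrow> 'c) \<Rightarrow> 'a set set" where
  "homog_open_bisections G T c = {B. openin T B \<and> bisection G B \<and> c constant_on B}"


section \<open>Semigroups of partial functions\<close>

definition one_cancellative :: "('y, 'm) monoid_scheme \<Rightarrow> bool" where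
  "one_cancellative Y \<longleftrightarrow> (\<forall>x \<in> carrier Y. \<forall>y \<in> carrier Y.
     (x \<otimes>\<^bsub>Y\<^esub> y = x \<longleftrightarrow> y = \<one>\<^bsub>Y\<^esub>) \<and> (y = \<one>\<^bsub>Y\<^esub> \<longleftrightarrow> y \<otimes>\<^bsub>Y\<^esub> x = x))"

definition pfuns :: "('y, 'm) monoid_scheme \<Rightarrow> 'a set set \<Rightarrow> ('a \<rightharpoonup> 'y) set" where
  "pfuns Y \<X> = {a. dom a \<in> \<X> \<and> ran a \<subseteq> carrier Y}"

definition preim :: "'y set \<Rightarrow> ('a \<rightharpoonup> 'y) \<Rightarrow> 'a set" where
  "preim W a = {g \<in> dom a. the (a g) \<in> W}"

text \<open>The value described below is unique whenever the domain of \<open>a\<close> or of \<open>b\<close> is a bisection;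
  see \<open>pf_mult_apply\<close>.\<close>

definition pf_mult :: "('a, 'm) groupoid_scheme \<Rightarrow> ('y, 'n) monoid_scheme \<Rightarrow>
    ('a \<rightharpoonup> 'y) \<Rightarrow> ('a \<rightharpoonup> 'y) \<Rightarrow> ('a \<rightharpoonup> 'y)" where
  "pf_mult G Y a b = (\<lambda>k. if k \<in> setprod G (dom a) (dom b)
     then Some (THE y. \<exists>g \<in> dom a. \<exists>h \<in> dom b. src G g = rng G h \<and> k = g \<cdot>\<^bsub>G\<^esub> h \<and>
       y = the (a g) \<otimes>\<^bsub>Y\<^esub> the (b h))
     else None)"

definition pf_semigroup ::
    "('a, 'm) groupoid_scheme \<Rightarrow> ('y, 'n) monoid_scheme \<Rightarrow> ('a \<rightharpoonup> 'y) set \<Rightarrow> bool" where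
  "pf_semigroup G Y S \<longleftrightarrow> (\<forall>a \<in> S. \<forall>b \<in> S. pf_mult G Y a b \<in> S)"

text \<open>In the last condition, the equation \<open>a(h\<inverse>) = b(h)\<inverse>\<close> includes that both
  sides are defined, in particular that \<open>b(h)\<close> is invertible in \<open>Y\<close>.\<close>

definition bumpy ::
    "('a, 'm) groupoid_scheme \<Rightarrow> 'a topology \<Rightarrow> ('y, 'n) monoid_scheme \<Rightarrow> ('a \<rightharpoonup> 'y) set \<Rightarrow> bool" where
  "bumpy G T Y S \<longleftrightarrow>
     (\<forall>a \<in> S. compactin T (preim {\<one>\<^bsub>Y\<^esub>} a)) \<and>
     (Map.empty \<in> S \<and>
      (\<forall>O' g. openin T O' \<and> g \<in> O' \<longrightarrow>
         (\<exists>a \<in> S. dom a \<subseteq> O' \<and> g \<in> T interior_of preim (Units Y) a))) \<and>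
     (\<forall>a \<in> S. \<forall>g \<in> T interior_of preim (Units Y) a.
        \<exists>b \<in> S. ginv G g \<in> T interior_of
          {h \<in> carrier G. ginv G h \<in> dom a \<and> h \<in> preim (Units Y) b \<and>
             the (a (ginv G h)) = inv\<^bsub>Y\<^esub> (the (b h))})"

definition diagonal :: "('a, 'm) groupoid_scheme \<Rightarrow> ('a \<rightharpoonup> 'y) set \<Rightarrow> ('a \<rightharpoonup> 'y) set" where
  "diagonal G S = {d \<in> S. dom d \<subseteq> units G}"

definition pf_iso ::
    "('a, 'm) groupoid_scheme \<Rightarrow> ('y, 'n) monoid_scheme \<Rightarrow> ('a \<rightharpoonup> 'y) set \<Rightarrow>
     ('b, 'p) groupoid_scheme \<Rightarrow> ('z, 'q) monoid_scheme \<Rightarrow> ('b \<rightharpoonup> 'z) set \<Rightarrow>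
     (('a \<rightharpoonup> 'y) \<Rightarrow> ('b \<rightharpoonup> 'z)) \<Rightarrow> bool" where
  "pf_iso G Y S G' Y' S' \<phi> \<longleftrightarrow> bij_betw \<phi> S S' \<and>
     (\<forall>a \<in> S. \<forall>b \<in> S. \<phi> (pf_mult G Y a b) = pf_mult G' Y' (\<phi> a) (\<phi> b))"

definition degree_of :: "('a \<Rightarrow> 'c) \<Rightarrow> ('a \<rightharpoonup> 'y) \<Rightarrow> 'c" where
  "degree_of c a = the_elem (c ` dom a)"

text \<open>An isomorphism of bumpy semigroups maps only the zero \<open>Map.empty\<close> to \<open>Map.empty\<close>, so both
  degrees below are those of functions with nonempty homogeneous domain.\<close>

definition graded_map ::
    "('a \<Rightarrow> 'c) \<Rightarrow> ('a \<rightharpoonup> 'y) set \<Rightarrow> ('b \<Rightarrow> 'c) \<Rightarrow> (('a \<rightharpoonup> 'y) \<Rightarrow> ('b \<rightharpoonup> 'z)) \<Rightarrow> bool" where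
  "graded_map c S c' \<phi> \<longleftrightarrow> (\<forall>a \<in> S - {Map.empty}. degree_of c a = degree_of c' (\<phi> a))"


section \<open>Well-definedness of the product\<close>

context groupoid
begin

lemma composableI:
  "\<lbrakk>g \<in> carrier G; h \<in> carrier G; src G g = rng G h\<rbrakk> \<Longrightarrow> (g, h) \<in> composable G"
  by (simp add: composable_def)

lemma src_ginv: "g \<in> carrier G \<Longrightarrow> src G (ginv G g) = rng G g"
  by (simp add: src_def rng_def ginv_ginv)

lemma rng_ginv: "g \<in> carrier G \<Longrightarrow> rng G (ginv G g) = src G g"
  by (simp add: src_def rng_def ginv_ginv)

lemma gmult_ginv_cancel_left:
  assumes "(g, h) \<in> composable G"
  shows "ginv G g \<cdot> (g \<cdot> h) = h"
proof -
  have "(ginv G g, g) \<in> composable G"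
    using assms by (simp add: composable_def ginv_closed src_ginv)
  then have "ginv G g \<cdot> (g \<cdot> h) = src G g \<cdot> h"
    using gmult_assoc assms by (simp add: src_def)
  then show ?thesis
    using assms rng_left_unit by (simp add: composable_def)
qed

lemma gmult_ginv_cancel_right:
  assumes "(g, h) \<in> composable G"
  shows "(g \<cdot> h) \<cdot> ginv G h = g"
proof -
  have "(h, ginv G h) \<in> composable G"
    using assms by (simp add: composable_def ginv_closed rng_ginv)
  then have "(g \<cdot> h) \<cdot> ginv G h = g \<cdot> rng G h"
    using gmult_assoc assms by (simp add: rng_def)
  then show ?thesis
    using assms src_right_unit by (auto simp: composable_def) metis
qed

lemma src_rng_unit:
  assumes "u \<in> units G"
  shows "src G u = u" "rng G u = u"
proof -
  obtain g where g: "g \<in> carrier G" "u = ginv G g \<cdot> g"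
    using assms by (auto simp: units_def src_def)
  have c: "(ginv G g, g) \<in> composable G"
    using g by (simp add: composable_def ginv_closed src_ginv)
  show "src G u = u" using src_gmult[OF c] g by (simp add: src_def)
  show "rng G u = u" using rng_gmult[OF c] g rng_ginv by (simp add: src_def)
qed

lemma bisection_src_inj:
  assumes B: "bisection G B" and gh: "g \<in> B" "h \<in> B" and eq: "src G g = src G h"
  shows "g = h"
proof -
  have cr: "g \<in> carrier G" "h \<in> carrier G" using B gh by (auto simp: bisection_def)
  have c: "(g, ginv G h) \<in> composable G"
    using cr eq by (simp add: composable_def ginv_closed rng_ginv)
  have "g \<cdot> ginv G h \<in> setprod G B (ginv G ` B)"
    using gh eq cr rng_ginv by (fastforce simp: setprod_def)
  then have "g \<cdot> ginv G h \<in> units G" using B by (auto simp: bisection_def)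
  then have *: "g \<cdot> ginv G h = rng G h"
    using src_rng_unit(1) src_gmult[OF c] src_ginv cr by metis
  have "g = (g \<cdot> ginv G h) \<cdot> ginv G (ginv G h)"
    using gmult_ginv_cancel_right[OF c] by simp
  also have "\<dots> = h" using * cr ginv_ginv rng_left_unit by simp
  finally show ?thesis .
qed

lemma bisection_rng_inj:
  assumes B: "bisection G B" and gh: "g \<in> B" "h \<in> B" and eq: "rng G g = rng G h"
  shows "g = h"
proof -
  have cr: "g \<in> carrier G" "h \<in> carrier G" using B gh by (auto simp: bisection_def)
  have c: "(ginv G g, h) \<in> composable G"
    using cr eq by (simp add: composable_def ginv_closed src_ginv)
  have "ginv G g \<cdot> h \<in> setprod G (ginv G ` B) B"
    using gh eq cr src_ginv by (fastforce simp: setprod_def)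
  then have "ginv G g \<cdot> h \<in> units G" using B by (auto simp: bisection_def)
  then have *: "ginv G g \<cdot> h = src G g"
    using src_rng_unit(2) rng_gmult[OF c] rng_ginv cr by metis
  have "h = ginv G (ginv G g) \<cdot> (ginv G g \<cdot> h)"
    using gmult_ginv_cancel_left[OF c] by simp
  also have "\<dots> = g" using * cr ginv_ginv src_right_unit by simp
  finally show ?thesis by simp
qed

lemma pf_mult_apply:
  assumes dom: "dom a \<subseteq> carrier G" "dom b \<subseteq> carrier G"
    and bis: "bisection G (dom a) \<or> bisection G (dom b)"
    and gh: "g \<in> dom a" "h \<in> dom b" "src G g = rng G h"
  shows "pf_mult G Y a b (g \<cdot> h) = Some (the (a g) \<otimes>\<^bsub>Y\<^esub> the (b h))"
proof -
  have unique: "g' = g \<and> h' = h"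
    if "g' \<in> dom a" "h' \<in> dom b" "src G g' = rng G h'" "g \<cdot> h = g' \<cdot> h'" for g' h'
  proof -
    have c: "(g, h) \<in> composable G" and c': "(g', h') \<in> composable G"
      using dom gh that by (auto intro!: composableI)
    have r: "rng G g' = rng G g" and s: "src G h' = src G h"
      using rng_gmult src_gmult c c' that(4) by metis+
    from bis show ?thesis
    proof
      assume "bisection G (dom a)"
      then have "g' = g" using bisection_rng_inj that(1) gh(1) r by blast
      then show ?thesis using gmult_ginv_cancel_left c c' that(4) by metis
    next
      assume "bisection G (dom b)"
      then have "h' = h" using bisection_src_inj that(2) gh(2) s by blast
      then show ?thesis using gmult_ginv_cancel_right c c' that(4) by metis
    qed
  qed
  have "g \<cdot> h \<in> setprod G (dom a) (dom b)" using gh by (auto simp: setprod_def)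
  moreover have "(THE y. \<exists>g' \<in> dom a. \<exists>h' \<in> dom b. src G g' = rng G h' \<and> g \<cdot> h = g' \<cdot> h' \<and>
       y = the (a g') \<otimes>\<^bsub>Y\<^esub> the (b h')) = the (a g) \<otimes>\<^bsub>Y\<^esub> the (b h)"
    by (rule the_equality) (use gh unique in blast)+
  ultimately show ?thesis by (simp add: pf_mult_def)
qed

end

end

theory Submission
  imports Defs
begin

text \<open>
  The points of \<open>G\<close> and all their structure are recovered from the semigroup \<open>S\<close> and its diagonal
  \<open>D(S)\<close>, so an isomorphism that preserves both induces an isomorphism of groupoids.

  That \<open>G\<close> is etale uses one semigroup only (\<open>etale\<close>).  Involutivity makes inversion open.
  Domains of functions in \<open>S\<close> are open and multiply like the functions, so products of open sets are
  open.  As open bisections form a basis, openness of products gives that the units are open, that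
  multiplication is continuous, and that the source map is a local homeomorphism.

  For the reconstruction, say that \<open>b\<close> dominates \<open>a\<close> if some \<open>s \<in> S\<close> satisfies \<open>sa \<in> D(S)\<close> and
  \<open>(as)b = a = b(sa)\<close>.  By 1-cancellation, \<open>s\<close> is then pointwise inverse to \<open>b\<close> over the domain of
  \<open>a\<close> (\<open>dominator_inverts\<close>), and since \<open>[1](bs)\<close> is compact, the domain of \<open>a\<close> lies in a compact
  subset of the domain of \<open>b\<close> (\<open>dominated_compactly_contained\<close>).  Conversely, if \<open>b\<close> is invertible
  near \<open>g\<close>, it dominates every function supported close enough to \<open>g\<close> (\<open>dominated_near\<close>).

  A point \<open>g\<close> is represented by the set \<open>bumps g\<close> of all \<open>a \<in> S\<close> that are invertible near \<open>g\<close>.  This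
  set is directed downwards for domination and omits the empty function.  Every nonempty family with these
  two properties is contained in some \<open>bumps g\<close>, by compactness
  (\<open>proper_directed_subset_bumps\<close>), and distinct points have incomparable sets of bumps
  (\<open>bumps_subset_imp_eq\<close>).  Since domination and the empty function are respected by the
  isomorphism \<open>\<phi>\<close>, there is a bijection \<open>\<psi>\<close> of points with \<open>\<phi>[bumps g] = bumps (\<psi> g)\<close>.

  The remaining structure is read off from bumps.  The interiors of the sets of invertibility form a
  basis of the topology, so \<open>\<psi>\<close> is a homeomorphism.  Two points are composable if and only if no
  product of their bumps is empty (\<open>composable_iff_bumps\<close>), and \<open>gh\<close> is the only point which has all
  products of a bump at \<open>g\<close> with a bump at \<open>h\<close> among its bumps (\<open>mult_in_bumps\<close>,
  \<open>gmult_eq_bumps\<close>).  Finally, the degree of a point is the degree of any of its bumps.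
\<close>


section \<open>Groupoid algebra\<close>

context groupoid
begin

lemma composable_ginv_self: "g \<in> carrier G \<Longrightarrow> (ginv G g, g) \<in> composable G"
  by (simp add: composable_def ginv_closed src_ginv)

lemma src_in_units: "g \<in> carrier G \<Longrightarrow> src G g \<in> units G"
  by (simp add: units_def)

lemma rng_in_units: "g \<in> carrier G \<Longrightarrow> rng G g \<in> units G"
  using src_in_units[OF ginv_closed] src_ginv by metis

lemma units_subset: "units G \<subseteq> carrier G"
  using gmult_closed composable_ginv_self by (auto simp: units_def src_def)

lemma gmult_unit_imp_inverse:
  assumes "(g, h) \<in> composable G" "g \<cdot> h \<in> units G"
  shows "h = ginv G g"
proof -
  have g: "g \<in> carrier G" using assms(1) by (simp add: composable_def)
  have "g \<cdot> h = rng G g" using assms rng_gmult src_rng_unit(2) by metis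
  then have "h = ginv G g \<cdot> src G (ginv G g)"
    using gmult_ginv_cancel_left[OF assms(1)] g src_ginv by simp
  then show ?thesis using src_right_unit ginv_closed g by simp
qed

lemma setprodI:
  "\<lbrakk>g \<in> A; h \<in> B; src G g = rng G h\<rbrakk> \<Longrightarrow> g \<cdot> h \<in> setprod G A B"
  by (auto simp: setprod_def)

lemma setprod_units_left:
  assumes "A \<subseteq> units G" "B \<subseteq> carrier G"
  shows "setprod G A B = {g \<in> B. rng G g \<in> A}"
proof (intro equalityI subsetI)
  fix k assume "k \<in> setprod G A B"
  then obtain u g where "u \<in> A" "g \<in> B" "src G u = rng G g" "k = u \<cdot> g"
    by (auto simp: setprod_def)
  then show "k \<in> {g \<in> B. rng G g \<in> A}"
    using assms src_rng_unit(1) rng_left_unit by (metis (mono_tags) mem_Collect_eq subsetD)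
next
  fix k assume k: "k \<in> {g \<in> B. rng G g \<in> A}"
  then have "src G (rng G k) = rng G k" using assms src_rng_unit(1) by blast
  then have "rng G k \<cdot> k \<in> setprod G A B" using k by (auto intro: setprodI)
  then show "k \<in> setprod G A B" using k assms rng_left_unit by auto
qed

lemma setprod_units_right:
  assumes "A \<subseteq> units G" "B \<subseteq> carrier G"
  shows "setprod G B A = {g \<in> B. src G g \<in> A}"
proof (intro equalityI subsetI)
  fix k assume "k \<in> setprod G B A"
  then obtain u g where "u \<in> A" "g \<in> B" "src G g = rng G u" "k = g \<cdot> u"
    by (auto simp: setprod_def)
  then show "k \<in> {g \<in> B. src G g \<in> A}"
    using assms src_rng_unit(2) src_right_unit by (metis (mono_tags) mem_Collect_eq subsetD)
next
  fix k assume k: "k \<in> {g \<in> B. src G g \<in> A}"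
  then have "rng G (src G k) = src G k" using assms src_rng_unit(2) by blast
  then have "k \<cdot> src G k \<in> setprod G B A" using k by (auto intro: setprodI)
  then show "k \<in> setprod G B A" using k assms src_right_unit by auto
qed

text \<open>By \<open>gmult_unit_imp_inverse\<close>, the only units in \<open>B\<^sup>-\<^sup>1 B\<close> are the products \<open>g\<^sup>-\<^sup>1 g\<close>.
  Together with the two lemmas above, this writes images and preimages of the source and range
  maps as products of sets, so that their openness will follow from that of products.\<close>

lemma src_image_eq:
  assumes "B \<subseteq> carrier G"
  shows "src G ` B = setprod G (ginv G ` B) B \<inter> units G"
proof (intro equalityI subsetI)
  fix u assume "u \<in> src G ` B"
  then obtain g where g: "g \<in> B" "u = ginv G g \<cdot> g" by (auto simp: src_def)
  then show "u \<in> setprod G (ginv G ` B) B \<inter> units G"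
    using assms setprodI[of "ginv G g" "ginv G ` B" g B] src_ginv src_in_units[of g]
    by (auto simp: src_def)
next
  fix u assume u: "u \<in> setprod G (ginv G ` B) B \<inter> units G"
  then obtain g h where gh: "g \<in> B" "h \<in> B" "src G (ginv G g) = rng G h" "u = ginv G g \<cdot> h"
    by (auto simp: setprod_def)
  have "h = ginv G (ginv G g)"
    using gmult_unit_imp_inverse[OF composableI[OF _ _ gh(3)]] gh u assms ginv_closed by blast
  then show "u \<in> src G ` B" using gh assms by (auto simp: ginv_ginv src_def)
qed

lemma rng_image_eq: "B \<subseteq> carrier G \<Longrightarrow> rng G ` B = src G ` ginv G ` B"
  by (force simp: image_image src_ginv)

end


section \<open>A bumpy semigroup forces the groupoid to be etale\<close>

locale bumpy_semigroup = groupoid G + vals: Group.monoid Y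
  for G :: "('a, 'm) groupoid_scheme" (structure) and Y :: "('y, 'n) monoid_scheme" +
  fixes T :: "'a topology" and S :: "('a \<rightharpoonup> 'y) set"
  assumes topspace_eq: "topspace T = carrier G"
    and Hausdorff_units: "Hausdorff_space (subtopology T (units G))"
    and one_cancel: "one_cancellative Y"
    and dom_open: "a \<in> S \<Longrightarrow> openin T (dom a)"
    and dom_bisection: "a \<in> S \<Longrightarrow> bisection G (dom a)"
    and ran_closed: "a \<in> S \<Longrightarrow> ran a \<subseteq> carrier Y"
    and mult_closed: "\<lbrakk>a \<in> S; b \<in> S\<rbrakk> \<Longrightarrow> pf_mult G Y a b \<in> S"
    and bumpy: "bumpy G T Y S"
begin

lemma dom_subset: "a \<in> S \<Longrightarrow> dom a \<subseteq> carrier G"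
  using dom_bisection by (simp add: bisection_def)

lemma dom_mult: "dom (pf_mult G Y a b) = setprod G (dom a) (dom b)"
  by (auto simp: pf_mult_def dom_def)

lemma mult_apply:
  assumes "a \<in> S" "b \<in> S" "g \<in> dom a" "h \<in> dom b" "src G g = rng G h"
  shows "pf_mult G Y a b (g \<cdot> h) = Some (the (a g) \<otimes>\<^bsub>Y\<^esub> the (b h))"
  by (rule pf_mult_apply[OF dom_subset[OF assms(1)] dom_subset[OF assms(2)]
        disjI1[OF dom_bisection[OF assms(1)]] assms(3-5)])

lemma val_closed: "\<lbrakk>a \<in> S; g \<in> dom a\<rbrakk> \<Longrightarrow> the (a g) \<in> carrier Y"
  using ran_closed by (fastforce simp: ran_def)

lemma empty_in: "Map.empty \<in> S"
  using bumpy by (simp add: bumpy_def)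

definition bump_set :: "('a \<rightharpoonup> 'y) \<Rightarrow> 'a set" where
  "bump_set a = T interior_of preim (Units Y) a"

lemma open_bump_set: "openin T (bump_set a)"
  by (simp add: bump_set_def)

lemma bump_set_subset: "bump_set a \<subseteq> preim (Units Y) a"
  by (simp add: bump_set_def interior_of_subset)

lemma bump_set_subset_dom: "bump_set a \<subseteq> dom a"
  using bump_set_subset by (auto simp: preim_def)

lemma bump_setI: "\<lbrakk>openin T B; B \<subseteq> preim (Units Y) a; g \<in> B\<rbrakk> \<Longrightarrow> g \<in> bump_set a"
  unfolding bump_set_def using interior_of_maximal by blast

lemma urysohn:
  assumes "openin T B" "g \<in> B"
  obtains a where "a \<in> S" "dom a \<subseteq> B" "g \<in> bump_set a"
proof -
  have "\<forall>B g. openin T B \<and> g \<in> B \<longrightarrow> (\<exists>a \<in> S. dom a \<subseteq> B \<and> g \<in> bump_set a)"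
    using bumpy by (simp add: bumpy_def bump_set_def)
  then show thesis using assms that by metis
qed

lemma local_inverse:
  assumes "a \<in> S" "g \<in> bump_set a"
  obtains b W where "b \<in> S" "openin T W" "ginv G g \<in> W"
    "\<And>h. h \<in> W \<Longrightarrow> h \<in> carrier G \<and> ginv G h \<in> dom a \<and> h \<in> dom b \<and> the (b h) \<in> Units Y \<and>
       the (a (ginv G h)) = inv\<^bsub>Y\<^esub> (the (b h))"
proof -
  have "\<forall>a \<in> S. \<forall>g \<in> T interior_of preim (Units Y) a. \<exists>b \<in> S. ginv G g \<in> T interior_of
          {h \<in> carrier G. ginv G h \<in> dom a \<and> h \<in> preim (Units Y) b \<and>
             the (a (ginv G h)) = inv\<^bsub>Y\<^esub> (the (b h))}"
    using bumpy unfolding bumpy_def by (elim conjE)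
  from bspec[OF bspec[OF this assms(1)] assms(2)[unfolded bump_set_def]]
  obtain b where b: "b \<in> S" "ginv G g \<in> T interior_of
          {h \<in> carrier G. ginv G h \<in> dom a \<and> h \<in> preim (Units Y) b \<and>
             the (a (ginv G h)) = inv\<^bsub>Y\<^esub> (the (b h))}" (is "_ \<in> T interior_of ?W")
    by (elim bexE) (rule that)
  show ?thesis
    by (rule that[of b "T interior_of ?W"])
      (use b interior_of_subset[of T ?W] in \<open>auto simp: preim_def\<close>)
qed

text \<open>Take a bump \<open>a\<close> at \<open>k\<close> with domain in \<open>B\<close>.  The neighbourhood of \<open>k\<^sup>-\<^sup>1\<close> on which some
  function in \<open>S\<close> is pointwise inverse to \<open>a\<close> lies in the inverse of the domain of \<open>a\<close>.\<close>

lemma open_ginv: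
  assumes B: "openin T B"
  shows "openin T (ginv G ` B)"
  unfolding openin_subopen[of T "ginv G ` B"]
proof
  fix g assume "g \<in> ginv G ` B"
  then obtain k where k: "k \<in> B" "g = ginv G k" by auto
  obtain a where a: "a \<in> S" "dom a \<subseteq> B" "k \<in> bump_set a" using urysohn B k by blast
  obtain b W where W: "openin T W" "ginv G k \<in> W"
    "\<And>h. h \<in> W \<Longrightarrow> h \<in> carrier G \<and> ginv G h \<in> dom a"
    using local_inverse[OF a(1,3)] by metis
  have "W \<subseteq> ginv G ` B"
  proof
    fix h assume "h \<in> W"
    then have "h \<in> carrier G" "ginv G h \<in> B" using W a by auto
    then show "h \<in> ginv G ` B" using ginv_ginv by (metis imageI)
  qed
  then show "\<exists>W. openin T W \<and> g \<in> W \<and> W \<subseteq> ginv G ` B" using W k by blast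
qed

text \<open>Products of open sets are open because domains of functions in \<open>S\<close> are open and multiply
  like the functions.\<close>

lemma open_setprod:
  assumes A: "openin T A" and B: "openin T B"
  shows "openin T (setprod G A B)"
  unfolding openin_subopen[of T "setprod G A B"]
proof
  fix k assume "k \<in> setprod G A B"
  then obtain g h where gh: "g \<in> A" "h \<in> B" "src G g = rng G h" "k = g \<cdot> h"
    by (auto simp: setprod_def)
  obtain a where a: "a \<in> S" "dom a \<subseteq> A" "g \<in> bump_set a" using urysohn A gh by blast
  obtain b where b: "b \<in> S" "dom b \<subseteq> B" "h \<in> bump_set b" using urysohn B gh by blast
  have "openin T (setprod G (dom a) (dom b))"
    using dom_open[OF mult_closed[OF a(1) b(1)]] by (simp add: dom_mult)
  moreover have "k \<in> setprod G (dom a) (dom b)"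
    unfolding gh(4)
    by (rule setprodI[OF subsetD[OF bump_set_subset_dom a(3)] subsetD[OF bump_set_subset_dom b(3)] gh(3)])
  moreover have "setprod G (dom a) (dom b) \<subseteq> setprod G A B"
    using a b unfolding setprod_def by blast
  ultimately show "\<exists>W. openin T W \<and> k \<in> W \<and> W \<subseteq> setprod G A B" by blast
qed

lemma open_subset_carrier: "openin T B \<Longrightarrow> B \<subseteq> carrier G"
  using openin_subset topspace_eq by blast

lemma open_carrier: "openin T (carrier G)"
  using openin_topspace topspace_eq by metis

lemma open_bisection_nbhd:
  assumes "openin T B" "g \<in> B"
  obtains N where "openin T N" "bisection G N" "g \<in> N" "N \<subseteq> B"
  using urysohn[OF assms] bump_set_subset_dom dom_bisection dom_open by (metis subsetD)

text \<open>If \<open>N\<close> is an open bisection around \<open>g\<close>, then \<open>N\<^sup>-\<^sup>1 N\<close> is an open set of units which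
  contains the source of \<open>g\<close>.\<close>

lemma open_units: "openin T (units G)"
  unfolding openin_subopen[of T "units G"]
proof
  fix u assume "u \<in> units G"
  then obtain g where g: "g \<in> carrier G" "u = src G g" by (auto simp: units_def)
  obtain N where N: "openin T N" "bisection G N" "g \<in> N"
    using open_bisection_nbhd open_carrier g by metis
  have "openin T (setprod G (ginv G ` N) N)" using open_setprod open_ginv N by simp
  moreover have "u \<in> setprod G (ginv G ` N) N"
    using src_image_eq[OF open_subset_carrier[OF N(1)]] N g by blast
  moreover have "setprod G (ginv G ` N) N \<subseteq> units G" using N by (simp add: bisection_def)
  ultimately show "\<exists>W. openin T W \<and> u \<in> W \<and> W \<subseteq> units G" by blast
qed

lemma open_src_image: "openin T B \<Longrightarrow> openin T (src G ` B)"
  by (simp add: src_image_eq open_subset_carrier open_setprod open_ginv open_units openin_Int)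

lemma open_rng_image: "openin T B \<Longrightarrow> openin T (rng G ` B)"
  by (simp add: rng_image_eq open_subset_carrier open_src_image open_ginv)

lemma continuous_src: "continuous_map T (subtopology T (units G)) (src G)"
  unfolding continuous_map
proof (intro conjI allI impI)
  show "src G ` topspace T \<subseteq> topspace (subtopology T (units G))"
    using topspace_eq src_in_units units_subset by auto
  fix U assume "openin (subtopology T (units G)) U"
  then have U: "openin T U" "U \<subseteq> units G" by (simp_all add: openin_open_subtopology open_units)
  then show "openin T {g \<in> topspace T. src G g \<in> U}"
    using open_setprod[OF open_carrier U(1)] setprod_units_right[OF U(2), of "carrier G"]
    by (simp add: topspace_eq)
qed

lemma continuous_rng: "continuous_map T (subtopology T (units G)) (rng G)"
  unfolding continuous_map
proof (intro conjI allI impI)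
  show "rng G ` topspace T \<subseteq> topspace (subtopology T (units G))"
    using topspace_eq rng_in_units units_subset by auto
  fix U assume "openin (subtopology T (units G)) U"
  then have U: "openin T U" "U \<subseteq> units G" by (simp_all add: openin_open_subtopology open_units)
  then show "openin T {g \<in> topspace T. rng G g \<in> U}"
    using open_setprod[OF U(1) open_carrier] setprod_units_left[OF U(2), of "carrier G"]
    by (simp add: topspace_eq)
qed

text \<open>If \<open>gh\<close> lies in the open set \<open>B\<close> and \<open>N\<close> is an open bisection around \<open>h\<close>, then
  \<open>B N\<^sup>-\<^sup>1\<close> is an open set around \<open>g\<close>, and \<open>B N\<^sup>-\<^sup>1 N \<subseteq> B\<close>.\<close>

lemma gmult_continuous_at:
  assumes B: "openin T B" and gh: "(g, h) \<in> composable G" "g \<cdot> h \<in> B"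
  obtains M N where "openin T M" "openin T N" "g \<in> M" "h \<in> N" "setprod G M N \<subseteq> B"
proof -
  have cr: "g \<in> carrier G" "h \<in> carrier G" "src G g = rng G h"
    using gh by (auto simp: composable_def)
  obtain N where N: "openin T N" "bisection G N" "h \<in> N"
    using open_bisection_nbhd open_carrier cr by metis
  have Nc: "N \<subseteq> carrier G" and Bc: "B \<subseteq> carrier G" using open_subset_carrier N B by auto
  let ?M = "setprod G B (ginv G ` N)"
  have "(g \<cdot> h) \<cdot> ginv G h \<in> ?M"
    using gh N cr src_gmult[OF gh(1)] rng_ginv setprodI by force
  then have "g \<in> ?M" using gmult_ginv_cancel_right gh by simp
  moreover have "setprod G ?M N \<subseteq> B"
  proof
    fix k assume "k \<in> setprod G ?M N"
    then obtain m n where mn: "m \<in> ?M" "n \<in> N" "src G m = rng G n" "k = m \<cdot> n"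
      unfolding setprod_def[of G ?M] by blast
    then obtain b p where bp: "b \<in> B" "p \<in> N" "src G b = rng G (ginv G p)" "m = b \<cdot> ginv G p"
      by (auto simp: setprod_def)
    have c: "(b, ginv G p) \<in> composable G"
      using bp Nc Bc ginv_closed composableI by blast
    have "rng G p = rng G n" using mn bp src_gmult[OF c] src_ginv Nc by auto
    then have "n = p" using bisection_rng_inj N mn bp by blast
    then have "k = b"
      using mn bp gmult_ginv_cancel_right[OF c] ginv_ginv Nc by auto
    then show "k \<in> B" using bp by simp
  qed
  ultimately show thesis using that[of ?M N] open_setprod open_ginv N B by blast
qed

theorem etale: "etale G T"
  unfolding etale_def
proof (intro conjI)
  have vim: "{g \<in> topspace T. ginv G g \<in> U} = ginv G ` U" if "U \<subseteq> carrier G" for U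
    using that ginv_closed ginv_ginv by (force simp: topspace_eq image_iff)
  show "continuous_map T T (ginv G)"
    unfolding continuous_map
    using ginv_closed open_ginv vim open_subset_carrier by (auto simp: topspace_eq)
  show "continuous_map (subtopology (prod_topology T T) (composable G)) T (\<lambda>(g, h). g \<cdot> h)"
    unfolding continuous_map
  proof (intro conjI allI impI)
    show "(\<lambda>(g, h). g \<cdot> h) ` topspace (subtopology (prod_topology T T) (composable G)) \<subseteq> topspace T"
      using gmult_closed by (auto simp: topspace_eq)
    fix U assume U: "openin T U"
    let ?P = "{x \<in> topspace (subtopology (prod_topology T T) (composable G)).
      (case x of (g, h) \<Rightarrow> g \<cdot> h) \<in> U}"
    show "openin (subtopology (prod_topology T T) (composable G)) ?P"
      unfolding openin_subopen[of _ ?P]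
    proof
      fix x assume "x \<in> ?P"
      then obtain g h where x: "x = (g, h)" "(g, h) \<in> composable G" "g \<cdot> h \<in> U" by auto
      obtain M N where MN: "openin T M" "openin T N" "g \<in> M" "h \<in> N" "setprod G M N \<subseteq> U"
        using gmult_continuous_at[OF U x(2,3)] by metis
      have "openin (prod_topology T T) (M \<times> N)" using MN by (simp add: openin_prod_Times_iff)
      then have "openin (subtopology (prod_topology T T) (composable G)) ((M \<times> N) \<inter> composable G)"
        by (simp add: openin_subtopology_Int)
      moreover have "(M \<times> N) \<inter> composable G \<subseteq> ?P"
      proof
        fix y assume "y \<in> (M \<times> N) \<inter> composable G"
        then obtain m n where y: "y = (m, n)" "m \<in> M" "n \<in> N" "(m, n) \<in> composable G" by blast
        then have "m \<cdot> n \<in> U" using MN setprodI[of m M n N] by (auto simp: composable_def)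
        then show "y \<in> ?P" using y by (auto simp: topspace_eq composable_def)
      qed
      ultimately show "\<exists>V. openin (subtopology (prod_topology T T) (composable G)) V \<and> x \<in> V \<and> V \<subseteq> ?P"
        using x MN by blast
    qed
  qed
  show "openin T (src G ` carrier G)" using open_src_image open_carrier by blast
  show "local_homeomorphism T (subtopology T (src G ` carrier G)) (src G)"
    unfolding local_homeomorphism_def
  proof
    fix g assume "g \<in> topspace T"
    then obtain N where N: "openin T N" "bisection G N" "g \<in> N"
      using open_bisection_nbhd open_carrier topspace_eq by metis
    have Nc: "N \<subseteq> carrier G" using open_subset_carrier N by blast
    have sN: "src G ` N \<subseteq> src G ` carrier G" "src G ` N \<subseteq> carrier G"
      using Nc src_in_units units_subset by auto
    have "homeomorphic_map (subtopology T N) (subtopology T (src G ` N)) (src G)"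
    proof (rule bijective_open_imp_homeomorphic_map)
      show "continuous_map (subtopology T N) (subtopology T (src G ` N)) (src G)"
        using continuous_src continuous_map_from_subtopology
        by (fastforce simp: continuous_map_in_subtopology)
      show "open_map (subtopology T N) (subtopology T (src G ` N)) (src G)"
        using N open_src_image by (auto simp: open_map_def openin_open_subtopology)
      show "src G ` topspace (subtopology T N) = topspace (subtopology T (src G ` N))"
        using Nc sN by (auto simp: topspace_eq)
      show "inj_on (src G) (topspace (subtopology T N))"
        using bisection_src_inj[OF N(2)] by (auto simp: inj_on_def)
    qed
    then show "\<exists>U. openin T U \<and> g \<in> U \<and> openin (subtopology T (src G ` carrier G)) (src G ` U) \<and>
      homeomorphic_map (subtopology T U)
        (subtopology (subtopology T (src G ` carrier G)) (src G ` U)) (src G)"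
      using N open_src_image sN
      by (intro exI[of _ N]) (auto simp: openin_open_subtopology open_carrier subtopology_subtopology Int_absorb1)
  qed
qed


section \<open>Domination\<close>

lemma rng_homeomorphic_map:
  assumes N: "openin T N" "bisection G N"
  shows "homeomorphic_map (subtopology T N) (subtopology T (rng G ` N)) (rng G)"
proof (rule bijective_open_imp_homeomorphic_map)
  have Nc: "N \<subseteq> carrier G" using open_subset_carrier N by blast
  then have rN: "rng G ` N \<subseteq> carrier G" using rng_in_units units_subset by blast
  show "continuous_map (subtopology T N) (subtopology T (rng G ` N)) (rng G)"
    using continuous_rng continuous_map_from_subtopology
    by (fastforce simp: continuous_map_in_subtopology)
  show "open_map (subtopology T N) (subtopology T (rng G ` N)) (rng G)"
    using N open_rng_image by (auto simp: open_map_def openin_open_subtopology)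
  show "rng G ` topspace (subtopology T N) = topspace (subtopology T (rng G ` N))"
    using Nc rN by (auto simp: topspace_eq)
  show "inj_on (rng G) (topspace (subtopology T N))"
    using bisection_rng_inj[OF N(2)] by (auto simp: inj_on_def)
qed

text \<open>The groupoid itself need not be Hausdorff; limits are unique only within one open bisection,
  which the range map embeds into the unit space.\<close>

lemma Hausdorff_bisection:
  assumes "openin T N" "bisection G N"
  shows "Hausdorff_space (subtopology T N)"
proof (rule Hausdorff_space_injective_preimage[OF Hausdorff_units])
  show "continuous_map (subtopology T N) (subtopology T (units G)) (rng G)"
    using continuous_rng continuous_map_from_subtopology by blast
  show "inj_on (rng G) (topspace (subtopology T N))"
    using bisection_rng_inj[OF assms(2)] by (auto simp: inj_on_def)
qed

end

text \<open>The witness \<open>s\<close> acts as an inverse of \<open>b\<close> over the domain of \<open>a\<close>.  The condition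
  \<open>sa \<in> D(S)\<close> aligns supports: an arrow of \<open>s\<close> that can be composed with an arrow of \<open>a\<close> must be
  its inverse.  It involves only the product and the diagonal, so it is respected by
  diagonal-preserving isomorphisms.\<close>

definition dominated :: "('a, 'm) groupoid_scheme \<Rightarrow> ('y, 'n) monoid_scheme \<Rightarrow>
    ('a \<rightharpoonup> 'y) set \<Rightarrow> ('a \<rightharpoonup> 'y) \<Rightarrow> ('a \<rightharpoonup> 'y) \<Rightarrow> bool" where
  "dominated G Y S a b \<longleftrightarrow> (\<exists>s \<in> S. pf_mult G Y s a \<in> diagonal G S \<and>
     pf_mult G Y (pf_mult G Y a s) b = a \<and> pf_mult G Y b (pf_mult G Y s a) = a)"

text \<open>Families of functions that shrink, in the sense of domination, towards a point.\<close>

definition proper_directed :: "('a, 'm) groupoid_scheme \<Rightarrow> ('y, 'n) monoid_scheme \<Rightarrow>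
    ('a \<rightharpoonup> 'y) set \<Rightarrow> ('a \<rightharpoonup> 'y) set \<Rightarrow> bool" where
  "proper_directed G Y S U \<longleftrightarrow> U \<subseteq> S \<and> U \<noteq> {} \<and> Map.empty \<notin> U \<and>
     (\<forall>a \<in> U. \<forall>b \<in> U. \<exists>d \<in> U. dominated G Y S d a \<and> dominated G Y S d b)"

context bumpy_semigroup
begin

text \<open>Evaluate \<open>b(sa) = a\<close> at \<open>g\<close>.  As \<open>sa\<close> lives on units, the arrow of \<open>b\<close> involved is \<open>g\<close>, and
  that of \<open>s\<close> is \<open>g\<^sup>-\<^sup>1\<close>; hence \<open>b(g) s(g\<^sup>-\<^sup>1) a(g) = a(g)\<close>, and 1-cancellation applies.  The other
  product comes from \<open>(as)b = a\<close> in the same way.\<close>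

lemma dominator_inverts:
  assumes S: "a \<in> S" "b \<in> S" "s \<in> S"
    and diag: "pf_mult G Y s a \<in> diagonal G S"
    and asb: "pf_mult G Y (pf_mult G Y a s) b = a"
    and bsa: "pf_mult G Y b (pf_mult G Y s a) = a"
    and g: "g \<in> dom a"
  shows "g \<in> dom b" "ginv G g \<in> dom s"
    "the (b g) \<otimes>\<^bsub>Y\<^esub> the (s (ginv G g)) = \<one>\<^bsub>Y\<^esub>"
    "the (s (ginv G g)) \<otimes>\<^bsub>Y\<^esub> the (b g) = \<one>\<^bsub>Y\<^esub>"
proof -
  have gc: "g \<in> carrier G" using g S dom_subset by blast
  have saS: "pf_mult G Y s a \<in> S" and asS: "pf_mult G Y a s \<in> S" using S mult_closed by auto
  have sau: "dom (pf_mult G Y s a) \<subseteq> units G" using diag by (simp add: diagonal_def)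
  have "g \<in> setprod G (dom b) (dom (pf_mult G Y s a))"
    using g bsa dom_mult by metis
  then have *: "g \<in> dom b" "src G g \<in> dom (pf_mult G Y s a)"
    using setprod_units_right[OF sau] S dom_subset by auto
  show gb: "g \<in> dom b" by (rule *)
  obtain l k where lk: "l \<in> dom s" "k \<in> dom a" "src G l = rng G k" "src G g = l \<cdot> k"
    using *(2) by (auto simp: dom_mult setprod_def)
  have c: "(l, k) \<in> composable G" using lk S dom_subset composableI by blast
  have "src G k = src G g"
    using src_gmult[OF c] lk src_rng_unit(1) src_in_units[OF gc] by metis
  then have "k = g" using bisection_src_inj dom_bisection S lk g by blast
  moreover have "k = ginv G l"
    using gmult_unit_imp_inverse[OF c] lk src_in_units[OF gc] by simp
  moreover have "ginv G (ginv G l) = l" using ginv_ginv lk S dom_subset by blast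
  ultimately have "l = ginv G g" by simp
  then show gs: "ginv G g \<in> dom s" using lk by simp
  have vals: "the (a g) \<in> carrier Y" "the (b g) \<in> carrier Y" "the (s (ginv G g)) \<in> carrier Y"
    using val_closed S g gb gs by auto
  have sg: "src G (ginv G g) = rng G g" "src G g = rng G (ginv G g)"
    using gc by (simp_all add: src_ginv rng_ginv)
  have sa: "pf_mult G Y s a (src G g) = Some (the (s (ginv G g)) \<otimes>\<^bsub>Y\<^esub> the (a g))"
    using mult_apply[OF S(3,1) gs g sg(1)] by (simp add: src_def)
  have ass: "pf_mult G Y a s (rng G g) = Some (the (a g) \<otimes>\<^bsub>Y\<^esub> the (s (ginv G g)))"
    using mult_apply[OF S(1,3) g gs sg(2)] by (simp add: rng_def)
  have "pf_mult G Y b (pf_mult G Y s a) (g \<cdot> src G g) =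
      Some (the (b g) \<otimes>\<^bsub>Y\<^esub> (the (s (ginv G g)) \<otimes>\<^bsub>Y\<^esub> the (a g)))"
    using mult_apply[OF S(2) saS gb *(2)] sa src_rng_unit(2)[OF src_in_units[OF gc]] by simp
  then have "a g = Some (the (b g) \<otimes>\<^bsub>Y\<^esub> (the (s (ginv G g)) \<otimes>\<^bsub>Y\<^esub> the (a g)))"
    unfolding bsa src_right_unit[OF gc] .
  then have "the (a g) = the (b g) \<otimes>\<^bsub>Y\<^esub> (the (s (ginv G g)) \<otimes>\<^bsub>Y\<^esub> the (a g))"
    by (metis option.sel)
  then have "(the (b g) \<otimes>\<^bsub>Y\<^esub> the (s (ginv G g))) \<otimes>\<^bsub>Y\<^esub> the (a g) = the (a g)"
    using vals vals.m_assoc by metis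
  then show "the (b g) \<otimes>\<^bsub>Y\<^esub> the (s (ginv G g)) = \<one>\<^bsub>Y\<^esub>"
    using one_cancel vals unfolding one_cancellative_def by (meson vals.m_closed)
  have rd: "rng G g \<in> dom (pf_mult G Y a s)" using ass by blast
  have "pf_mult G Y (pf_mult G Y a s) b (rng G g \<cdot> g) =
      Some ((the (a g) \<otimes>\<^bsub>Y\<^esub> the (s (ginv G g))) \<otimes>\<^bsub>Y\<^esub> the (b g))"
    using mult_apply[OF asS S(2) rd gb] ass src_rng_unit(1)[OF rng_in_units[OF gc]] by simp
  then have "a g = Some ((the (a g) \<otimes>\<^bsub>Y\<^esub> the (s (ginv G g))) \<otimes>\<^bsub>Y\<^esub> the (b g))"
    unfolding asb rng_left_unit[OF gc] .
  then have "the (a g) = (the (a g) \<otimes>\<^bsub>Y\<^esub> the (s (ginv G g))) \<otimes>\<^bsub>Y\<^esub> the (b g)"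
    by (metis option.sel)
  then have "the (a g) \<otimes>\<^bsub>Y\<^esub> (the (s (ginv G g)) \<otimes>\<^bsub>Y\<^esub> the (b g)) = the (a g)"
    using vals vals.m_assoc by metis
  then show "the (s (ginv G g)) \<otimes>\<^bsub>Y\<^esub> the (b g) = \<one>\<^bsub>Y\<^esub>"
    using one_cancel vals unfolding one_cancellative_def by (meson vals.m_closed)
qed

lemma dominated_dom_subset_bump_set:
  assumes "a \<in> S" "b \<in> S" "dominated G Y S a b"
  shows "dom a \<subseteq> bump_set b"
proof -
  obtain s where s: "s \<in> S" "pf_mult G Y s a \<in> diagonal G S"
    "pf_mult G Y (pf_mult G Y a s) b = a" "pf_mult G Y b (pf_mult G Y s a) = a"
    using assms(3) by (auto simp: dominated_def)
  have "dom a \<subseteq> preim (Units Y) b"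
  proof
    fix g assume "g \<in> dom a"
    note inv = dominator_inverts[OF assms(1,2) s this]
    then show "g \<in> preim (Units Y) b"
      using val_closed[OF assms(2) inv(1)] val_closed[OF s(1) inv(2)]
      unfolding preim_def Units_def by blast
  qed
  then show ?thesis using bump_setI dom_open assms by blast
qed

text \<open>On the range of \<open>a\<close> the product \<open>bs\<close> has value 1, and the set \<open>[1](bs)\<close> is compact.
  Its range is a compact set of units, which is pulled back along the homeomorphism that the
  range map induces on the bisection \<open>dom b\<close>.\<close>

lemma dominated_compactly_contained:
  assumes ab: "a \<in> S" "b \<in> S" and dom: "dominated G Y S a b"
  obtains C where "compactin T C" "dom a \<subseteq> C" "C \<subseteq> dom b"
proof -
  obtain s where s: "s \<in> S" "pf_mult G Y s a \<in> diagonal G S"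
    "pf_mult G Y (pf_mult G Y a s) b = a" "pf_mult G Y b (pf_mult G Y s a) = a"
    using dom by (auto simp: dominated_def)
  let ?K = "preim {\<one>\<^bsub>Y\<^esub>} (pf_mult G Y b s)"
  let ?C = "{h \<in> dom b. rng G h \<in> rng G ` ?K}"
  have K: "compactin T ?K" using bumpy mult_closed ab s by (auto simp: bumpy_def)
  have "rng G ` ?K \<subseteq> rng G ` dom b"
  proof
    fix u assume "u \<in> rng G ` ?K"
    then obtain g h where "g \<in> dom b" "h \<in> dom s" "src G g = rng G h" "u = rng G (g \<cdot> h)"
      by (auto simp: preim_def dom_mult setprod_def)
    moreover have "(g, h) \<in> composable G"
      using calculation ab s dom_subset composableI by blast
    ultimately show "u \<in> rng G ` dom b" using rng_gmult by auto
  qed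
  moreover have "rng G ` {h \<in> dom b. rng G h \<in> A} = A \<inter> rng G ` dom b" for A by blast
  ultimately have rC: "rng G ` ?C = rng G ` ?K" by auto
  have "compactin (subtopology T (units G)) (rng G ` ?K)"
    using image_compactin[OF K continuous_rng] .
  then have "compactin (subtopology T (rng G ` dom b)) (rng G ` ?C)"
    unfolding rC compactin_subtopology using \<open>rng G ` ?K \<subseteq> rng G ` dom b\<close> by blast
  moreover have "?C \<subseteq> topspace (subtopology T (dom b))"
    using ab dom_subset by (auto simp: topspace_eq)
  ultimately have "compactin (subtopology T (dom b)) ?C"
    using homeomorphic_map_compactness[OF rng_homeomorphic_map[OF dom_open[OF ab(2)] dom_bisection[OF ab(2)]]]
    by blast
  then have "compactin T ?C" by (simp add: compactin_subtopology)
  moreover have "dom a \<subseteq> ?C"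
  proof
    fix g assume g: "g \<in> dom a"
    note inv = dominator_inverts[OF ab s g]
    have gc: "g \<in> carrier G" using g ab dom_subset by blast
    have "pf_mult G Y b s (rng G g) = Some \<one>\<^bsub>Y\<^esub>"
      using mult_apply[OF ab(2) s(1) inv(1,2)] inv(3) rng_ginv[OF gc] by (simp add: rng_def)
    then have "rng G g \<in> ?K" by (auto simp: preim_def)
    then have "rng G (rng G g) \<in> rng G ` ?K" by (rule imageI)
    then have "rng G g \<in> rng G ` ?K" using src_rng_unit(2)[OF rng_in_units[OF gc]] by simp
    then show "g \<in> ?C" using inv(1) by simp
  qed
  ultimately show thesis using that by blast
qed

text \<open>There are enough dominated functions: if \<open>s\<close> is pointwise inverse to \<open>b\<close> near \<open>g\<close>, then \<open>s\<close>
  witnesses that \<open>b\<close> dominates every function supported close enough to \<open>g\<close>.  All arrows of \<open>s\<close>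
  that meet \<open>a\<close> are then inverses of arrows of \<open>a\<close>, however large the domain of \<open>s\<close> is.\<close>

lemma dominated_near:
  assumes b: "b \<in> S" "g \<in> bump_set b"
  obtains B where "openin T B" "g \<in> B" "\<And>a. \<lbrakk>a \<in> S; dom a \<subseteq> B\<rbrakk> \<Longrightarrow> dominated G Y S a b"
proof -
  obtain s W where s: "s \<in> S" and W: "openin T W" "ginv G g \<in> W"
    "\<And>h. h \<in> W \<Longrightarrow> h \<in> carrier G \<and> ginv G h \<in> dom b \<and> h \<in> dom s \<and> the (s h) \<in> Units Y \<and>
       the (b (ginv G h)) = inv\<^bsub>Y\<^esub> (the (s h))"
    using local_inverse[OF b] by metis
  have gc: "g \<in> carrier G" using b bump_set_subset_dom dom_subset by blast
  have dom: "dominated G Y S a b" if a: "a \<in> S" "dom a \<subseteq> ginv G ` W" for a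
  proof -
    have inv: "k \<in> dom b \<and> ginv G k \<in> dom s \<and> the (s (ginv G k)) \<in> Units Y \<and>
        the (b k) = inv\<^bsub>Y\<^esub> (the (s (ginv G k)))" if "k \<in> dom a" for k
    proof -
      obtain h where h: "h \<in> W" "k = ginv G h" using a \<open>k \<in> dom a\<close> by blast
      then show ?thesis using W(3)[OF h(1)] ginv_ginv by simp
    qed
    have ac: "dom a \<subseteq> carrier G" and sc: "dom s \<subseteq> carrier G" and bc: "dom b \<subseteq> carrier G"
      using a s b dom_subset by auto
    have dsa: "dom (pf_mult G Y s a) = src G ` dom a"
    proof (intro equalityI subsetI)
      fix u assume "u \<in> dom (pf_mult G Y s a)"
      then obtain l k where lk: "l \<in> dom s" "k \<in> dom a" "src G l = rng G k" "u = l \<cdot> k"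
        by (auto simp: dom_mult setprod_def)
      moreover have "src G l = src G (ginv G k)" using lk src_ginv ac by auto
      ultimately have "l = ginv G k"
        using inv[OF lk(2)] bisection_src_inj[OF dom_bisection[OF s]] by blast
      then show "u \<in> src G ` dom a" using lk by (simp add: src_def)
    next
      fix u assume "u \<in> src G ` dom a"
      then obtain k where k: "k \<in> dom a" "u = ginv G k \<cdot> k" by (auto simp: src_def)
      then show "u \<in> dom (pf_mult G Y s a)"
        unfolding dom_mult using inv[OF k(1)] ac src_ginv by (auto intro!: setprodI)
    qed
    have das: "dom (pf_mult G Y a s) = rng G ` dom a"
    proof (intro equalityI subsetI)
      fix u assume "u \<in> dom (pf_mult G Y a s)"
      then obtain k l where lk: "l \<in> dom s" "k \<in> dom a" "src G k = rng G l" "u = k \<cdot> l"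
        by (auto simp: dom_mult setprod_def)
      moreover have "rng G l = rng G (ginv G k)" using lk rng_ginv ac by auto
      ultimately have "l = ginv G k"
        using inv[OF lk(2)] bisection_rng_inj[OF dom_bisection[OF s]] by blast
      then show "u \<in> rng G ` dom a" using lk by (simp add: rng_def)
    next
      fix u assume "u \<in> rng G ` dom a"
      then obtain k where k: "k \<in> dom a" "u = k \<cdot> ginv G k" by (auto simp: rng_def)
      then show "u \<in> dom (pf_mult G Y a s)"
        unfolding dom_mult using inv[OF k(1)] ac rng_ginv by (auto intro!: setprodI)
    qed
    have srcu: "src G ` dom a \<subseteq> units G" and rngu: "rng G ` dom a \<subseteq> units G"
      using ac src_in_units rng_in_units by auto
    have saS: "pf_mult G Y s a \<in> S" and asS: "pf_mult G Y a s \<in> S" using mult_closed a s by auto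
    have dasb: "dom (pf_mult G Y (pf_mult G Y a s) b) = dom a"
      unfolding dom_mult[of "pf_mult G Y a s"] das setprod_units_left[OF rngu bc]
      using inv bisection_rng_inj[OF dom_bisection[OF b(1)]] by blast
    have dbsa: "dom (pf_mult G Y b (pf_mult G Y s a)) = dom a"
      unfolding dom_mult[of b] dsa setprod_units_right[OF srcu bc]
      using inv bisection_src_inj[OF dom_bisection[OF b(1)]] by blast
    have vals: "pf_mult G Y (pf_mult G Y a s) b k = a k \<and> pf_mult G Y b (pf_mult G Y s a) k = a k"
      if k: "k \<in> dom a" for k
    proof -
      have kc: "k \<in> carrier G" using k ac by blast
      have sg: "src G (ginv G k) = rng G k" "src G k = rng G (ginv G k)"
        using kc by (simp_all add: src_ginv rng_ginv)
      have kb: "k \<in> dom b" and ks: "ginv G k \<in> dom s" and U: "the (s (ginv G k)) \<in> Units Y"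
        and bk: "the (b k) = inv\<^bsub>Y\<^esub> (the (s (ginv G k)))"
        using inv[OF k] by auto
      have cl: "the (a k) \<in> carrier Y" using val_closed a k by blast
      have sa: "pf_mult G Y s a (src G k) = Some (the (s (ginv G k)) \<otimes>\<^bsub>Y\<^esub> the (a k))"
        using mult_apply[OF s a(1) ks k sg(1)] by (simp add: src_def)
      have ass: "pf_mult G Y a s (rng G k) = Some (the (a k) \<otimes>\<^bsub>Y\<^esub> the (s (ginv G k)))"
        using mult_apply[OF a(1) s k ks sg(2)] by (simp add: rng_def)
      have sd: "src G k \<in> dom (pf_mult G Y s a)" and rd: "rng G k \<in> dom (pf_mult G Y a s)"
        using sa ass by blast+
      have "pf_mult G Y b (pf_mult G Y s a) (k \<cdot> src G k) =
          Some (the (b k) \<otimes>\<^bsub>Y\<^esub> (the (s (ginv G k)) \<otimes>\<^bsub>Y\<^esub> the (a k)))"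
        using mult_apply[OF b(1) saS kb sd] sa src_rng_unit(2)[OF src_in_units[OF kc]]
        by simp
      also have "\<dots> = Some (the (a k))"
        using cl U bk vals.m_assoc[of "the (b k)" "the (s (ginv G k))" "the (a k)", symmetric]
        by (simp add: vals.Units_closed vals.Units_inv_closed vals.Units_l_inv)
      finally have 1: "pf_mult G Y b (pf_mult G Y s a) k = a k"
        using src_right_unit[OF kc] k by auto
      have "pf_mult G Y (pf_mult G Y a s) b (rng G k \<cdot> k) =
          Some ((the (a k) \<otimes>\<^bsub>Y\<^esub> the (s (ginv G k))) \<otimes>\<^bsub>Y\<^esub> the (b k))"
        using mult_apply[OF asS b(1) rd kb] ass src_rng_unit(1)[OF rng_in_units[OF kc]]
        by simp
      also have "\<dots> = Some (the (a k))"
        using cl U bk vals.m_assoc[of "the (a k)" "the (s (ginv G k))" "the (b k)"]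
        by (simp add: vals.Units_closed vals.Units_inv_closed vals.Units_r_inv)
      finally show ?thesis using 1 rng_left_unit[OF kc] k by auto
    qed
    have "pf_mult G Y (pf_mult G Y a s) b = a" "pf_mult G Y b (pf_mult G Y s a) = a"
      by (rule ext, metis vals dasb domIff) (rule ext, metis vals dbsa domIff)
    moreover have "pf_mult G Y s a \<in> diagonal G S"
      using saS dsa srcu by (simp add: diagonal_def)
    ultimately show ?thesis using s by (auto simp: dominated_def)
  qed
  have "g \<in> ginv G ` W" using W(2) ginv_ginv[OF gc] by (metis imageI)
  then show thesis using that[of "ginv G ` W"] open_ginv W dom by blast
qed


section \<open>Points as families of bumps\<close>

text \<open>These families are exactly the ultrafilters of the domination relation; below this appears
  in the form that they are proper directed, absorb every proper directed family, and are pairwise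
  incomparable.\<close>

definition bumps :: "'a \<Rightarrow> ('a \<rightharpoonup> 'y) set" where
  "bumps g = {a \<in> S. g \<in> bump_set a}"

lemma bumps_proper_directed:
  assumes g: "g \<in> carrier G"
  shows "proper_directed G Y S (bumps g)"
  unfolding proper_directed_def
proof (intro conjI ballI)
  show "bumps g \<subseteq> S" by (auto simp: bumps_def)
  obtain a where "a \<in> S" "g \<in> bump_set a" using urysohn[OF open_carrier g] by metis
  then show "bumps g \<noteq> {}" by (auto simp: bumps_def)
  show "Map.empty \<notin> bumps g" using bump_set_subset_dom by (fastforce simp: bumps_def)
  fix a b assume "a \<in> bumps g" "b \<in> bumps g"
  then have ab: "a \<in> S" "g \<in> bump_set a" "b \<in> S" "g \<in> bump_set b" by (auto simp: bumps_def)
  obtain A where A: "openin T A" "g \<in> A" "\<And>d. \<lbrakk>d \<in> S; dom d \<subseteq> A\<rbrakk> \<Longrightarrow> dominated G Y S d a"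
    using dominated_near[OF ab(1,2)] by metis
  obtain B where B: "openin T B" "g \<in> B" "\<And>d. \<lbrakk>d \<in> S; dom d \<subseteq> B\<rbrakk> \<Longrightarrow> dominated G Y S d b"
    using dominated_near[OF ab(3,4)] by metis
  obtain d where "d \<in> S" "dom d \<subseteq> A \<inter> B" "g \<in> bump_set d"
    using urysohn[of "A \<inter> B" g] A B by blast
  then show "\<exists>d\<in>bumps g. dominated G Y S d a \<and> dominated G Y S d b"
    using A(3) B(3) by (auto simp: bumps_def)
qed

text \<open>The domains of the members of \<open>U\<close> have a common point \<open>g\<close> by compactness.  Fix \<open>a \<in> U\<close>; the
  compact subsets of \<open>dom a\<close> which contain the domain of a member of \<open>U\<close> are closed in the
  Hausdorff space \<open>dom a\<close> and have the finite intersection property.  Every \<open>b \<in> U\<close> dominates some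
  \<open>d \<in> U\<close>, and \<open>g \<in> dom d\<close> lies in the open set \<open>dom d\<close> on which \<open>b\<close> is invertible.\<close>

lemma proper_directed_subset_bumps:
  assumes U: "proper_directed G Y S U"
  obtains g where "g \<in> carrier G" "U \<subseteq> bumps g"
proof -
  have US: "U \<subseteq> S" and ne: "U \<noteq> {}" and em: "Map.empty \<notin> U"
    and dir: "\<And>a b. \<lbrakk>a \<in> U; b \<in> U\<rbrakk> \<Longrightarrow> \<exists>d\<in>U. dominated G Y S d a \<and> dominated G Y S d b"
    using U by (auto simp: proper_directed_def)
  obtain a where a: "a \<in> U" using ne by blast
  let ?X = "subtopology T (dom a)"
  define F where "F = {C. compactin T C \<and> C \<subseteq> dom a \<and> (\<exists>d\<in>U. dom d \<subseteq> C)}"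
  have aS: "a \<in> S" using a US by blast
  have Haus: "Hausdorff_space ?X" using Hausdorff_bisection dom_open dom_bisection aS by blast
  have shrink: "\<exists>d\<in>U. dom d \<subseteq> dom b1 \<inter> dom b2" if b: "b1 \<in> U" "b2 \<in> U" for b1 b2
  proof -
    obtain d where d: "d \<in> U" "dominated G Y S d b1" "dominated G Y S d b2" using dir b by blast
    have "dom d \<subseteq> dom b1" "dom d \<subseteq> dom b2"
      using dominated_dom_subset_bump_set[of d] bump_set_subset_dom d b US by blast+
    then show ?thesis using d by blast
  qed
  \<comment> \<open>Two steps of domination: the first enters \<open>dom a \<inter> dom b\<close>, the second yields a compact set
    inside.  The compact set obtained from \<open>b\<close> directly might leave \<open>dom a\<close>.\<close>
  have small: "\<exists>C\<in>F. C \<subseteq> dom b" if b: "b \<in> U" for b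
  proof -
    obtain d where d: "d \<in> U" "dominated G Y S d a" "dominated G Y S d b" using dir a b by blast
    obtain e where e: "e \<in> U" "dominated G Y S e d" using dir d by blast
    have dS: "d \<in> S" "e \<in> S" "b \<in> S" using d e b US by auto
    obtain C where C: "compactin T C" "dom e \<subseteq> C" "C \<subseteq> dom d"
      using dominated_compactly_contained[OF dS(2,1) e(2)] by metis
    have "dom d \<subseteq> dom a" "dom d \<subseteq> dom b"
      using dominated_dom_subset_bump_set dS aS d bump_set_subset_dom by blast+
    then have "C \<in> F" "C \<subseteq> dom b" using C e unfolding F_def by blast+
    then show ?thesis by blast
  qed
  obtain C0 where C0: "C0 \<in> F" using small[OF a] by blast
  have cpt: "compactin ?X C0" using C0 by (simp add: compactin_subtopology F_def)
  have closed: "closedin ?X C" if "C \<in> F" for C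
    using that compactin_imp_closedin[OF Haus] by (simp add: compactin_subtopology F_def)
  have fip: "\<exists>d\<in>U. dom d \<subseteq> \<Inter>\<F>" if "finite \<F>" "\<F> \<subseteq> F" for \<F>
    using that
  proof (induction \<F> rule: finite_induct)
    case empty
    then show ?case using a by auto
  next
    case (insert C \<F>)
    then obtain d e where de: "d \<in> U" "dom d \<subseteq> \<Inter>\<F>" "e \<in> U" "dom e \<subseteq> C" by (auto simp: F_def)
    obtain f where "f \<in> U" "dom f \<subseteq> dom d \<inter> dom e" using shrink[OF de(1,3)] by blast
    then have "dom f \<subseteq> \<Inter>(insert C \<F>)" using de by blast
    then show ?case using \<open>f \<in> U\<close> by blast
  qed
  have "C0 \<inter> \<Inter>F \<noteq> {}"
  proof -
    have "C0 \<inter> \<Inter>\<F> \<noteq> {}" if F: "finite \<F>" "\<F> \<subseteq> F" for \<F>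
    proof -
      obtain d where d: "d \<in> U" "dom d \<subseteq> \<Inter>(insert C0 \<F>)"
        using fip[of "insert C0 \<F>"] F C0 by auto
      have "d \<noteq> Map.empty" using d(1) em by blast
      then have "dom d \<noteq> {}" by simp
      then show ?thesis using d by blast
    qed
    moreover have "\<forall>\<U>. (\<forall>C\<in>\<U>. closedin ?X C) \<and>
        (\<forall>\<F>. finite \<F> \<and> \<F> \<subseteq> \<U> \<longrightarrow> C0 \<inter> \<Inter>\<F> \<noteq> {}) \<longrightarrow> C0 \<inter> \<Inter>\<U> \<noteq> {}"
      using cpt by (simp add: compactin_fip)
    ultimately show ?thesis using closed by simp
  qed
  then obtain g where g: "g \<in> C0" "\<And>C. C \<in> F \<Longrightarrow> g \<in> C" by blast
  have gdom: "g \<in> dom b" if "b \<in> U" for b using small[OF that] g by blast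
  have "U \<subseteq> bumps g"
  proof
    fix b assume b: "b \<in> U"
    obtain d where d: "d \<in> U" "dominated G Y S d b" using dir b by blast
    have "g \<in> bump_set b" using dominated_dom_subset_bump_set[of d b] gdom[OF d(1)] d b US by blast
    then show "b \<in> bumps g" using b US by (auto simp: bumps_def)
  qed
  moreover have "g \<in> carrier G" using gdom[OF a] dom_subset[OF aS] by blast
  ultimately show thesis using that by blast
qed

lemma open_separation:
  assumes "g \<in> carrier G" "h \<in> carrier G" "g \<noteq> h"
  obtains B where "openin T B" "g \<in> B" "h \<notin> B"
proof (cases "rng G g = rng G h")
  case True
  obtain N where N: "openin T N" "bisection G N" "g \<in> N"
    using open_bisection_nbhd open_carrier assms by metis
  then have "h \<notin> N" using bisection_rng_inj True assms(3) by blast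
  then show thesis using that N by blast
next
  case False
  have "topspace (subtopology T (units G)) = units G" using units_subset by (auto simp: topspace_eq)
  then obtain M N where MN: "openin (subtopology T (units G)) M" "rng G g \<in> M" "rng G h \<in> N" "disjnt M N"
    using Hausdorff_units assms False rng_in_units unfolding Hausdorff_space_def by metis
  have "openin T {k \<in> topspace T. rng G k \<in> M}"
    using continuous_rng MN(1) by (simp add: continuous_map)
  then show thesis
    using that[of "{k \<in> topspace T. rng G k \<in> M}"] MN assms by (auto simp: topspace_eq disjnt_iff)
qed

lemma bumps_subset_imp_eq:
  assumes "g \<in> carrier G" "h \<in> carrier G" "bumps g \<subseteq> bumps h"
  shows "g = h"
proof (rule ccontr)
  assume "g \<noteq> h"
  then obtain B where B: "openin T B" "g \<in> B" "h \<notin> B" using open_separation assms by metis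
  obtain a where "a \<in> S" "dom a \<subseteq> B" "g \<in> bump_set a" using urysohn[OF B(1,2)] by metis
  then show False using assms(3) B bump_set_subset_dom unfolding bumps_def by blast
qed

lemma mult_in_bumps:
  assumes gh: "(g, h) \<in> composable G" and a: "a \<in> bumps g" and b: "b \<in> bumps h"
  shows "pf_mult G Y a b \<in> bumps (g \<cdot> h)"
proof -
  have ab: "a \<in> S" "g \<in> bump_set a" "b \<in> S" "h \<in> bump_set b" using a b by (auto simp: bumps_def)
  have "setprod G (bump_set a) (bump_set b) \<subseteq> preim (Units Y) (pf_mult G Y a b)"
  proof
    fix k assume "k \<in> setprod G (bump_set a) (bump_set b)"
    then obtain m n where mn: "m \<in> bump_set a" "n \<in> bump_set b" "src G m = rng G n" "k = m \<cdot> n"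
      by (auto simp: setprod_def)
    have m: "m \<in> dom a" "the (a m) \<in> Units Y" and n: "n \<in> dom b" "the (b n) \<in> Units Y"
      using mn bump_set_subset by (auto simp: preim_def)
    show "k \<in> preim (Units Y) (pf_mult G Y a b)"
      using mult_apply[OF ab(1,3) m(1) n(1) mn(3)] m n mn(4) by (auto simp: preim_def)
  qed
  moreover have "g \<cdot> h \<in> setprod G (bump_set a) (bump_set b)"
    using ab gh by (auto simp: composable_def intro: setprodI)
  ultimately have "g \<cdot> h \<in> bump_set (pf_mult G Y a b)"
    using bump_setI open_setprod open_bump_set by blast
  then show ?thesis using mult_closed ab by (simp add: bumps_def)
qed

text \<open>If the source of \<open>g\<close> differs from the range of \<open>h\<close>, separate these two units; bumps
  whose sources and ranges stay on the two sides have empty product.\<close>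

lemma composable_iff_bumps:
  assumes g: "g \<in> carrier G" and h: "h \<in> carrier G"
  shows "(g, h) \<in> composable G \<longleftrightarrow> (\<forall>a\<in>bumps g. \<forall>b\<in>bumps h. pf_mult G Y a b \<noteq> Map.empty)"
proof
  assume "(g, h) \<in> composable G"
  moreover have "Map.empty \<notin> bumps (g \<cdot> h)"
    using bump_set_subset_dom by (fastforce simp: bumps_def)
  ultimately show "\<forall>a\<in>bumps g. \<forall>b\<in>bumps h. pf_mult G Y a b \<noteq> Map.empty"
    using mult_in_bumps by metis
next
  assume nz: "\<forall>a\<in>bumps g. \<forall>b\<in>bumps h. pf_mult G Y a b \<noteq> Map.empty"
  show "(g, h) \<in> composable G"
  proof (rule ccontr)
    assume "(g, h) \<notin> composable G"
    then have ne: "src G g \<noteq> rng G h" using g h composableI by blast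
    have top: "topspace (subtopology T (units G)) = units G"
      using units_subset by (auto simp: topspace_eq)
    obtain M N where MN: "openin (subtopology T (units G)) M" "openin (subtopology T (units G)) N"
      "src G g \<in> M" "rng G h \<in> N" "disjnt M N"
      using Hausdorff_units ne g h rng_in_units src_in_units top unfolding Hausdorff_space_def
      by metis
    have "openin T {k \<in> topspace T. src G k \<in> M}" "openin T {k \<in> topspace T. rng G k \<in> N}"
      using continuous_src continuous_rng MN by (simp_all add: continuous_map)
    then obtain a b where a: "a \<in> S" "dom a \<subseteq> {k \<in> topspace T. src G k \<in> M}" "g \<in> bump_set a"
      and b: "b \<in> S" "dom b \<subseteq> {k \<in> topspace T. rng G k \<in> N}" "h \<in> bump_set b"
      using urysohn[of "{k \<in> topspace T. src G k \<in> M}" g]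
        urysohn[of "{k \<in> topspace T. rng G k \<in> N}" h] MN g h topspace_eq
      by (metis (mono_tags, lifting) mem_Collect_eq)
    have "setprod G (dom a) (dom b) = {}"
      using a(2) b(2) MN(5) by (fastforce simp: setprod_def disjnt_iff)
    then have "pf_mult G Y a b = Map.empty" by (metis dom_mult dom_eq_empty_conv)
    then show False using nz a b by (auto simp: bumps_def)
  qed
qed

text \<open>By continuity of multiplication, the domains of the products \<open>ab\<close> shrink to the point
  \<open>gh\<close>.\<close>

lemma gmult_eq_bumps:
  assumes gh: "(g, h) \<in> composable G" and k: "k \<in> carrier G"
    and ab: "\<And>a b. \<lbrakk>a \<in> bumps g; b \<in> bumps h\<rbrakk> \<Longrightarrow> pf_mult G Y a b \<in> bumps k"
  shows "k = g \<cdot> h"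
proof (rule ccontr)
  assume "k \<noteq> g \<cdot> h"
  then obtain B where B: "openin T B" "g \<cdot> h \<in> B" "k \<notin> B"
    using open_separation[OF gmult_closed[OF gh] k] by metis
  obtain M N where MN: "openin T M" "openin T N" "g \<in> M" "h \<in> N" "setprod G M N \<subseteq> B"
    using gmult_continuous_at[OF B(1) gh B(2)] by metis
  obtain a where a: "a \<in> S" "dom a \<subseteq> M" "g \<in> bump_set a" using urysohn[OF MN(1,3)] by metis
  obtain b where b: "b \<in> S" "dom b \<subseteq> N" "h \<in> bump_set b" using urysohn[OF MN(2,4)] by metis
  have "pf_mult G Y a b \<in> bumps k" using ab a b by (simp add: bumps_def)
  then have "k \<in> dom (pf_mult G Y a b)" using bump_set_subset_dom by (auto simp: bumps_def)
  then have "k \<in> setprod G M N" unfolding dom_mult setprod_def using a b by blast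
  then show False using MN B by blast
qed

end


section \<open>Transport along an isomorphism\<close>

locale bumpy_iso =
  left: bumpy_semigroup G Y T S + right: bumpy_semigroup G' Y' T' S'
  for G :: "('a, 'm) groupoid_scheme" and Y :: "('y, 'n) monoid_scheme" and T S
    and G' :: "('b, 'p) groupoid_scheme" and Y' :: "('z, 'q) monoid_scheme" and T' S' +
  fixes \<phi> :: "('a \<rightharpoonup> 'y) \<Rightarrow> ('b \<rightharpoonup> 'z)"
  assumes iso: "pf_iso G Y S G' Y' S' \<phi>"
    and diag: "\<phi> ` diagonal G S = diagonal G' S'"
begin

lemma bij: "bij_betw \<phi> S S'"
  using iso by (simp add: pf_iso_def)

lemma maps: "a \<in> S \<Longrightarrow> \<phi> a \<in> S'"
  using bij bij_betwE by blast

lemma map_mult: "\<lbrakk>a \<in> S; b \<in> S\<rbrakk> \<Longrightarrow> \<phi> (pf_mult G Y a b) = pf_mult G' Y' (\<phi> a) (\<phi> b)"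
  using iso by (simp add: pf_iso_def)

lemma inverse: "bumpy_iso G' Y' T' S' G Y T S (inv_into S \<phi>)"
proof unfold_locales
  have inj: "inj_on \<phi> S" and im: "\<phi> ` S = S'" using bij by (auto simp: bij_betw_def)
  have "inv_into S \<phi> (pf_mult G' Y' x y) = pf_mult G Y (inv_into S \<phi> x) (inv_into S \<phi> y)"
    if "x \<in> S'" "y \<in> S'" for x y
  proof -
    obtain a where a: "a \<in> S" "x = \<phi> a" using \<open>x \<in> S'\<close> im by blast
    obtain b where b: "b \<in> S" "y = \<phi> b" using \<open>y \<in> S'\<close> im by blast
    note ab = a(1) b(1) a(2) b(2)
    have "inv_into S \<phi> (\<phi> (pf_mult G Y a b)) = pf_mult G Y a b"
      using inv_into_f_f[OF inj] left.mult_closed ab by blast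
    then show ?thesis using ab inv_into_f_f[OF inj] map_mult by simp
  qed
  then show "pf_iso G' Y' S' G Y S (inv_into S \<phi>)"
    using bij_betw_inv_into[OF bij] by (simp add: pf_iso_def)
  have "diagonal G S \<subseteq> S" by (auto simp: diagonal_def)
  then show "inv_into S \<phi> ` diagonal G' S' = diagonal G S"
    using inv_into_image_cancel[OF inj] diag by metis
qed

text \<open>The empty function is the absorbing element of the semigroup.\<close>

lemma map_empty: "\<phi> Map.empty = Map.empty"
proof -
  obtain z where z: "z \<in> S" "\<phi> z = Map.empty"
    using bij right.empty_in by (metis bij_betw_imp_surj_on image_iff)
  have "pf_mult G Y Map.empty z = Map.empty"
    by (rule ext) (simp add: pf_mult_def setprod_def)
  then have "\<phi> Map.empty = pf_mult G' Y' (\<phi> Map.empty) Map.empty"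
    using map_mult[OF left.empty_in z(1)] z by simp
  also have "\<dots> = Map.empty" by (rule ext) (simp add: pf_mult_def setprod_def)
  finally show ?thesis .
qed

lemma map_eq_empty_iff: "a \<in> S \<Longrightarrow> \<phi> a = Map.empty \<longleftrightarrow> a = Map.empty"
  using map_empty bij left.empty_in by (metis bij_betw_imp_inj_on inj_onD)

lemma map_dominated:
  assumes "a \<in> S" "b \<in> S" "dominated G Y S a b"
  shows "dominated G' Y' S' (\<phi> a) (\<phi> b)"
proof -
  obtain s where s: "s \<in> S" "pf_mult G Y s a \<in> diagonal G S"
    "pf_mult G Y (pf_mult G Y a s) b = a" "pf_mult G Y b (pf_mult G Y s a) = a"
    using assms(3) by (auto simp: dominated_def)
  have "pf_mult G' Y' (\<phi> s) (\<phi> a) \<in> diagonal G' S'"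
    using s(1,2) diag map_mult assms(1) by (metis imageI)
  moreover have "pf_mult G' Y' (pf_mult G' Y' (\<phi> a) (\<phi> s)) (\<phi> b) = \<phi> a"
    "pf_mult G' Y' (\<phi> b) (pf_mult G' Y' (\<phi> s) (\<phi> a)) = \<phi> a"
    using s map_mult assms left.mult_closed by metis+
  ultimately show ?thesis using maps s(1) by (auto simp: dominated_def)
qed

lemma map_proper_directed:
  assumes "proper_directed G Y S U"
  shows "proper_directed G' Y' S' (\<phi> ` U)"
proof -
  have U: "U \<subseteq> S" "U \<noteq> {}" "Map.empty \<notin> U"
    "\<And>a b. \<lbrakk>a \<in> U; b \<in> U\<rbrakk> \<Longrightarrow> \<exists>d\<in>U. dominated G Y S d a \<and> dominated G Y S d b"
    using assms by (auto simp: proper_directed_def)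
  show ?thesis
    unfolding proper_directed_def
  proof (intro conjI ballI)
    show "\<phi> ` U \<subseteq> S'" "\<phi> ` U \<noteq> {}" using U maps by auto
    have "\<phi> a \<noteq> Map.empty" if "a \<in> U" for a using that U(1,3) map_eq_empty_iff[of a] by auto
    then show "Map.empty \<notin> \<phi> ` U" by (metis imageE)
    fix x y assume "x \<in> \<phi> ` U" "y \<in> \<phi> ` U"
    then obtain a b where ab: "a \<in> U" "b \<in> U" "x = \<phi> a" "y = \<phi> b" by blast
    then obtain d where d: "d \<in> U" "dominated G Y S d a" "dominated G Y S d b" using U by blast
    then have "dominated G' Y' S' (\<phi> d) x" "dominated G' Y' S' (\<phi> d) y"
      using ab U(1) map_dominated by auto
    then show "\<exists>z\<in>\<phi> ` U. dominated G' Y' S' z x \<and> dominated G' Y' S' z y" using d by blast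
  qed
qed

lemma image_bumps_subset:
  assumes "g \<in> carrier G"
  obtains h where "h \<in> carrier G'" "\<phi> ` left.bumps g \<subseteq> right.bumps h"
  using right.proper_directed_subset_bumps[OF map_proper_directed[OF left.bumps_proper_directed[OF assms]]]
  by metis

text \<open>The image of \<open>bumps g\<close> lies in some \<open>bumps h\<close>, whose preimage lies in some \<open>bumps k\<close>.  So
  \<open>bumps g \<subseteq> bumps k\<close>, which forces \<open>g = k\<close> and makes both inclusions equalities.\<close>

lemma image_bumps:
  assumes g: "g \<in> carrier G"
  obtains h where "h \<in> carrier G'" "\<phi> ` left.bumps g = right.bumps h"
proof -
  interpret inv: bumpy_iso G' Y' T' S' G Y T S "inv_into S \<phi>" by (rule inverse)
  have inj: "inj_on \<phi> S" and im: "\<phi> ` S = S'" using bij by (auto simp: bij_betw_def)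
  obtain h where h: "h \<in> carrier G'" "\<phi> ` left.bumps g \<subseteq> right.bumps h"
    using image_bumps_subset g by metis
  obtain k where k: "k \<in> carrier G" "inv_into S \<phi> ` right.bumps h \<subseteq> left.bumps k"
    using inv.image_bumps_subset h by metis
  have "left.bumps g \<subseteq> left.bumps k"
  proof
    fix a assume a: "a \<in> left.bumps g"
    then have "inv_into S \<phi> (\<phi> a) = a" using inv_into_f_f[OF inj] by (simp add: left.bumps_def)
    then show "a \<in> left.bumps k" using a h k by force
  qed
  then have "g = k" using left.bumps_subset_imp_eq g k by blast
  have "right.bumps h \<subseteq> \<phi> ` left.bumps g"
  proof
    fix x assume x: "x \<in> right.bumps h"
    then have "\<phi> (inv_into S \<phi> x) = x" using f_inv_into_f im by (metis (no_types, lifting) mem_Collect_eq right.bumps_def)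
    then show "x \<in> \<phi> ` left.bumps g" using x k \<open>g = k\<close> by (metis image_eqI image_subset_iff)
  qed
  then show thesis using that h by blast
qed

definition point_map :: "'a \<Rightarrow> 'b" where
  "point_map g = (SOME h. h \<in> carrier G' \<and> \<phi> ` left.bumps g = right.bumps h)"

lemma point_map:
  assumes "g \<in> carrier G"
  shows "point_map g \<in> carrier G'" "\<phi> ` left.bumps g = right.bumps (point_map g)"
proof -
  have "\<exists>h. h \<in> carrier G' \<and> \<phi> ` left.bumps g = right.bumps h" using image_bumps assms by metis
  then have "point_map g \<in> carrier G' \<and> \<phi> ` left.bumps g = right.bumps (point_map g)"
    unfolding point_map_def by (rule someI_ex)
  then show "point_map g \<in> carrier G'" "\<phi> ` left.bumps g = right.bumps (point_map g)" by auto
qed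

lemma point_map_bij: "bij_betw point_map (carrier G) (carrier G')"
proof (rule bij_betw_imageI)
  have inj: "inj_on \<phi> S" and im: "\<phi> ` S = S'" using bij by (auto simp: bij_betw_def)
  show "inj_on point_map (carrier G)"
  proof (rule inj_onI)
    fix g h assume gh: "g \<in> carrier G" "h \<in> carrier G" "point_map g = point_map h"
    then have "\<phi> ` left.bumps g = \<phi> ` left.bumps h" using point_map(2) by simp
    moreover have "left.bumps g \<subseteq> S" "left.bumps h \<subseteq> S" by (auto simp: left.bumps_def)
    ultimately have "left.bumps g = left.bumps h" using inj by (simp add: inj_on_image_eq_iff)
    then show "g = h" using left.bumps_subset_imp_eq gh by simp
  qed
  show "point_map ` carrier G = carrier G'"
  proof (intro equalityI subsetI)
    fix h assume h: "h \<in> carrier G'"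
    interpret inv: bumpy_iso G' Y' T' S' G Y T S "inv_into S \<phi>" by (rule inverse)
    obtain g where g: "g \<in> carrier G" "inv_into S \<phi> ` right.bumps h = left.bumps g"
      using inv.image_bumps h by metis
    have "right.bumps h \<subseteq> \<phi> ` S" using im by (auto simp: right.bumps_def)
    then have "\<phi> ` left.bumps g = right.bumps h" using g image_inv_into_cancel[OF refl] by metis
    then have "point_map g = h"
      using point_map[OF g(1)] right.bumps_subset_imp_eq h by simp
    then show "h \<in> point_map ` carrier G" using g by blast
  qed (use point_map in auto)
qed

lemma point_map_bump_set:
  assumes "a \<in> S" "g \<in> carrier G"
  shows "point_map g \<in> right.bump_set (\<phi> a) \<longleftrightarrow> g \<in> left.bump_set a"
proof -
  have "point_map g \<in> right.bump_set (\<phi> a) \<longleftrightarrow> \<phi> a \<in> \<phi> ` left.bumps g"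
    using point_map(2)[OF assms(2)] maps[OF assms(1)] by (simp add: right.bumps_def)
  also have "\<dots> \<longleftrightarrow> a \<in> left.bumps g"
    using assms bij inj_on_image_mem_iff[of \<phi> S a "left.bumps g"]
    by (auto simp: bij_betw_def left.bumps_def)
  finally show ?thesis using assms by (simp add: left.bumps_def)
qed

lemma point_map_image_bump_set:
  assumes "a \<in> S"
  shows "point_map ` left.bump_set a = right.bump_set (\<phi> a)"
proof -
  have "left.bump_set a \<subseteq> carrier G" "right.bump_set (\<phi> a) \<subseteq> carrier G'"
    using left.open_subset_carrier left.open_bump_set right.open_subset_carrier right.open_bump_set
    by auto
  moreover have "point_map ` carrier G = carrier G'"
    using bij_betw_imp_surj_on[OF point_map_bij] .
  ultimately show ?thesis using point_map_bump_set[OF assms]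
    by (intro equalityI subsetI; force)
qed

text \<open>By the Urysohn property the sets \<open>bump_set a\<close> form a basis of the topology, and the map on
  points carries one basis to the other.\<close>

lemma point_map_homeomorphic: "homeomorphic_map T T' point_map"
proof (rule bijective_open_imp_homeomorphic_map)
  show "point_map ` topspace T = topspace T'" "inj_on point_map (topspace T)"
    using point_map_bij by (auto simp: bij_betw_def left.topspace_eq right.topspace_eq)
  show "open_map T T' point_map"
    unfolding open_map_def
  proof (intro allI impI)
    fix B assume B: "openin T B"
    show "openin T' (point_map ` B)"
      unfolding openin_subopen[of T' "point_map ` B"]
    proof
      fix h assume "h \<in> point_map ` B"
      then obtain g where g: "g \<in> B" "h = point_map g" by blast
      obtain a where a: "a \<in> S" "dom a \<subseteq> B" "g \<in> left.bump_set a"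
        using left.urysohn[OF B g(1)] by metis
      have "point_map ` left.bump_set a \<subseteq> point_map ` B"
        using a(2) left.bump_set_subset_dom by blast
      moreover have "openin T' (point_map ` left.bump_set a)"
        using point_map_image_bump_set[OF a(1)] right.open_bump_set by simp
      moreover have "h \<in> point_map ` left.bump_set a" using a(3) g(2) by blast
      ultimately show "\<exists>W. openin T' W \<and> h \<in> W \<and> W \<subseteq> point_map ` B" by blast
    qed
  qed
  show "continuous_map T T' point_map"
    unfolding continuous_map
  proof (intro conjI allI impI)
    show "point_map ` topspace T \<subseteq> topspace T'"
      using point_map(1) by (auto simp: left.topspace_eq right.topspace_eq)
    fix B assume B: "openin T' B"
    let ?P = "{g \<in> topspace T. point_map g \<in> B}"
    show "openin T ?P"
      unfolding openin_subopen[of T ?P]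
    proof
      fix g assume g: "g \<in> ?P"
      then obtain x where x: "x \<in> S'" "dom x \<subseteq> B" "point_map g \<in> right.bump_set x"
        using right.urysohn[OF B] by blast
      obtain a where a: "a \<in> S" "x = \<phi> a" using x(1) bij by (auto simp: bij_betw_def)
      have "g \<in> left.bump_set a" using point_map_bump_set a x g by (simp add: left.topspace_eq)
      moreover have "point_map ` left.bump_set a \<subseteq> B"
        using point_map_image_bump_set a x right.bump_set_subset_dom by blast
      then have "left.bump_set a \<subseteq> ?P"
        using openin_subset[OF left.open_bump_set] by blast
      ultimately show "\<exists>W. openin T W \<and> g \<in> W \<and> W \<subseteq> ?P"
        using left.open_bump_set by blast
    qed
  qed
qed

lemma point_map_composable_iff:
  assumes g: "g \<in> carrier G" and h: "h \<in> carrier G"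
  shows "(point_map g, point_map h) \<in> composable G' \<longleftrightarrow> (g, h) \<in> composable G"
proof -
  have nz: "pf_mult G' Y' (\<phi> a) (\<phi> b) \<noteq> Map.empty \<longleftrightarrow> pf_mult G Y a b \<noteq> Map.empty"
    if "a \<in> left.bumps g" "b \<in> left.bumps h" for a b
    using that map_mult map_eq_empty_iff[OF left.mult_closed] by (simp add: left.bumps_def flip: map_mult)
  have "(point_map g, point_map h) \<in> composable G' \<longleftrightarrow>
      (\<forall>x\<in>\<phi> ` left.bumps g. \<forall>y\<in>\<phi> ` left.bumps h. pf_mult G' Y' x y \<noteq> Map.empty)"
    using right.composable_iff_bumps point_map g h by simp
  also have "\<dots> \<longleftrightarrow> (g, h) \<in> composable G"
    using left.composable_iff_bumps[OF g h] nz by simp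
  finally show ?thesis .
qed

lemma point_map_mult:
  assumes gh: "(g, h) \<in> composable G"
  shows "point_map (gmult G g h) = gmult G' (point_map g) (point_map h)"
proof (rule right.gmult_eq_bumps)
  have c: "g \<in> carrier G" "h \<in> carrier G" using gh by (auto simp: composable_def)
  have m: "gmult G g h \<in> carrier G" using left.gmult_closed[OF gh] .
  show "(point_map g, point_map h) \<in> composable G'" using point_map_composable_iff c gh by simp
  show "point_map (gmult G g h) \<in> carrier G'" using point_map m by simp
  fix x y assume "x \<in> right.bumps (point_map g)" "y \<in> right.bumps (point_map h)"
  then obtain a b where ab: "a \<in> left.bumps g" "b \<in> left.bumps h" "x = \<phi> a" "y = \<phi> b"
    using point_map(2) c by blast
  then have "pf_mult G' Y' x y = \<phi> (pf_mult G Y a b)"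
    using map_mult by (simp add: left.bumps_def)
  then show "pf_mult G' Y' x y \<in> right.bumps (point_map (gmult G g h))"
    using left.mult_in_bumps[OF gh ab(1,2)] point_map(2)[OF m] by blast
qed

lemma point_map_iso: "groupoid_iso G G' point_map"
proof -
  let ?i = "inv_into (carrier G) point_map"
  have i: "?i x \<in> carrier G" "point_map (?i x) = x" if "x \<in> carrier G'" for x
    using that point_map_bij bij_betw_imp_surj_on inv_into_into f_inv_into_f by metis+
  have "groupoid_hom G G' point_map"
    unfolding groupoid_hom_def
  proof (intro conjI ballI, safe)
    fix g h assume gh: "(g, h) \<in> composable G"
    then show "(point_map g, point_map h) \<in> composable G'"
      using point_map_composable_iff by (simp add: composable_def)
    show "point_map (gmult G g h) = gmult G' (point_map g) (point_map h)"
      using point_map_mult gh .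
  qed (use point_map in auto)
  moreover have "groupoid_hom G' G ?i"
    unfolding groupoid_hom_def
  proof (intro conjI ballI, safe)
    fix x y assume xy: "(x, y) \<in> composable G'"
    then have c: "x \<in> carrier G'" "y \<in> carrier G'" by (auto simp: composable_def)
    show ixy: "(?i x, ?i y) \<in> composable G"
      using point_map_composable_iff[of "?i x" "?i y"] i c xy by simp
    have "point_map (gmult G (?i x) (?i y)) = gmult G' x y" using point_map_mult[OF ixy] i c by simp
    then show "?i (gmult G' x y) = gmult G (?i x) (?i y)"
      using left.gmult_closed[OF ixy] bij_betw_inv_into_left[OF point_map_bij] by metis
  qed (use i in auto)
  ultimately show ?thesis using point_map_bij by (simp add: groupoid_iso_def)
qed

lemma point_map_grading:
  assumes graded: "graded_map c S c' \<phi>"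
    and const: "\<And>a. a \<in> S \<Longrightarrow> c constant_on dom a" "\<And>x. x \<in> S' \<Longrightarrow> c' constant_on dom x"
    and g: "g \<in> carrier G"
  shows "c' (point_map g) = c g"
proof -
  have deg: "degree_of f a = f k" if f: "f constant_on dom a" and k: "k \<in> dom a"
    for f :: "'s \<Rightarrow> 't" and a :: "'s \<rightharpoonup> 'u" and k
  proof -
    obtain y where "\<And>x. x \<in> dom a \<Longrightarrow> f x = y" using f by (auto simp: constant_on_def)
    then have "f ` dom a = {f k}" using k by (auto simp: image_iff)
    then show ?thesis by (simp add: degree_of_def)
  qed
  obtain a where a: "a \<in> S" "g \<in> left.bump_set a"
    using left.urysohn[OF left.open_carrier g] by metis
  have ga: "g \<in> dom a" using a left.bump_set_subset_dom by blast
  have "point_map g \<in> dom (\<phi> a)"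
    using point_map_bump_set[OF a(1) g] a(2) right.bump_set_subset_dom by blast
  then have "c' (point_map g) = degree_of c' (\<phi> a)" using deg[OF const(2)[OF maps[OF a(1)]]] by simp
  also have "\<dots> = degree_of c a"
  proof -
    have "a \<noteq> Map.empty" using ga by auto
    then show ?thesis using graded a(1) unfolding graded_map_def by simp
  qed
  also have "\<dots> = c g" using deg[OF const(1)[OF a(1)] ga] .
  finally show ?thesis .
qed

end


section \<open>The reconstruction theorem\<close>

theorem corollary9p4:
  fixes G :: "'a groupoid" and T :: "'a topology"
    and G' :: "'b groupoid" and T' :: "'b topology"
    and \<Gamma> :: "'c groupoid" and c :: "'a \<Rightarrow> 'c" and c' :: "'b \<Rightarrow> 'c"
    and Y :: "'y monoid" and Y' :: "'z monoid"
    and S :: "('a \<rightharpoonup> 'y) set" and S' :: "('b \<rightharpoonup> 'z) set"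
    and \<phi> :: "('a \<rightharpoonup> 'y) \<Rightarrow> ('b \<rightharpoonup> 'z)"
  assumes "groupoid G" and "topspace T = carrier G" and "Hausdorff_space (subtopology T (units G))"
    and "groupoid G'" and "topspace T' = carrier G'" and "Hausdorff_space (subtopology T' (units G'))"
    and "groupoid \<Gamma>" and "grading G \<Gamma> c" and "grading G' \<Gamma> c'"
    and "Group.monoid Y" and "one_cancellative Y"
    and "Group.monoid Y'" and "one_cancellative Y'"
    and "S \<subseteq> pfuns Y (homog_open_bisections G T c)" and "pf_semigroup G Y S" and "bumpy G T Y S"
    and "S' \<subseteq> pfuns Y' (homog_open_bisections G' T' c')" and "pf_semigroup G' Y' S'"
    and "bumpy G' T' Y' S'"
    and "pf_iso G Y S G' Y' S' \<phi>" and "graded_map c S c' \<phi>"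
    and "\<phi> ` diagonal G S = diagonal G' S'"
  shows "etale G T \<and> etale G' T' \<and>
    (\<exists>\<psi>. groupoid_iso G G' \<psi> \<and> homeomorphic_map T T' \<psi> \<and> (\<forall>g \<in> carrier G. c' (\<psi> g) = c g))"
proof -
  have left: "bumpy_semigroup G Y T S"
    using assms unfolding bumpy_semigroup_def bumpy_semigroup_axioms_def
    by (auto simp: pfuns_def homog_open_bisections_def pf_semigroup_def)
  have right: "bumpy_semigroup G' Y' T' S'"
    using assms unfolding bumpy_semigroup_def bumpy_semigroup_axioms_def
    by (auto simp: pfuns_def homog_open_bisections_def pf_semigroup_def)
  interpret bumpy_iso G Y T S G' Y' T' S' \<phi>
    using left right assms by (simp add: bumpy_iso_def bumpy_iso_axioms_def)
  have "c' (point_map g) = c g" if "g \<in> carrier G" for g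
  proof (rule point_map_grading[OF _ _ _ that])
    show "graded_map c S c' \<phi>" by fact
    show "c constant_on dom a" if "a \<in> S" for a
      using that \<open>S \<subseteq> pfuns Y _\<close> by (auto simp: pfuns_def homog_open_bisections_def)
    show "c' constant_on dom x" if "x \<in> S'" for x
      using that \<open>S' \<subseteq> pfuns Y' _\<close> by (auto simp: pfuns_def homog_open_bisections_def)
  qed
  then show ?thesis
    using left.etale right.etale point_map_iso point_map_homeomorphic by blast
qed

end
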